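(* Let $X_1,\dots,X_N$ be real-valued, jointly wide-sense stationary discrete-time random processes whose power spectral densities $\Phi_{X_i}(\omega)$ and cross-power spectral densities $\Phi_{X_iX_j}(\omega)$ exist as functions on $[-\pi,\pi]$, with $\Phi_{X_i}(\omega)>0$ for almost every $\omega$. Define $$d(X_i,X_j)=\left[\frac{1}{2\pi}\int_{-\pi}^{\pi}\bigl(1-C_{X_iX_j}(\omega)\bigr)\,d\omega\right]^{1/2},\qquad C_{X_iX_j}(\omega)=\frac{|\Phi_{X_jX_i}(\omega)|^2}{\Phi_{X_i}(\omega)\Phi_{X_j}(\omega)}.$$ Then the function $d(\cdot,\cdot)$ is a metric.
   Context: For jointly wide-sense stationary discrete-time processes $X,Y$, the cross-covariance function is $R_{XY}(\tau)=E[X(t)Y(t+\tau)]$, $\tau\in\mathbb{Z}$, where $E$ is the mean operator. The cross-power spectral density $\Phi_{XY}(z)$ is the zeta-transform of $R_{XY}$, $\Phi_{XY}(\omega)$ denotes $\Phi_{XY}(e^{i\omega})$, and $\Phi_X=\Phi_{XX}$ is the power spectral density. The function $C_{XY}$ is the coherence function of the two processes; it takes values in $[0,1]$ by the Schwarz inequality for cross-spectral densities. The number $d(X_i,X_j)^2$ is the minimum, over linear stable (possibly non-causal) filters $W_{ji}(z)$, of the energy of the error $X_j-W_{ji}(z)X_i$ weighted by the inverse of the spectral factor of $\Phi_{X_j}$; the minimizer is the Wiener filter $\hat W_{ji}(z)=\Phi_{X_iX_j}(z)/\Phi_{X_i}(z)$.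
   Formalization: The function d is shown to be a metric after identifying processes that are linear (possibly non-causal, mean-square) filterings of each other; literally d is not a metric, since X_2 = 2X_1 gives d(X_1,X_2) = 0 with X_1 ≠ X_2. *)

theory Defs
  imports "HOL-Probability.Probability"
begin

text \<open>
  A real-valued discrete-time random process on the probability space \<open>M\<close> is a function
  \<open>X :: int \<Rightarrow> 'a \<Rightarrow> real\<close>, with \<open>X t\<close> the random variable at time \<open>t\<close>.
\<close>

definition jointly_wss :: "'a measure \<Rightarrow> (int \<Rightarrow> 'a \<Rightarrow> real) \<Rightarrow> (int \<Rightarrow> 'a \<Rightarrow> real) \<Rightarrow> bool" where
  "jointly_wss M X Y \<longleftrightarrow>
     (\<forall>t. X t \<in> borel_measurable M \<and> integrable M (\<lambda>\<xi>. (X t \<xi>)\<^sup>2)) \<and>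
     (\<forall>t. Y t \<in> borel_measurable M \<and> integrable M (\<lambda>\<xi>. (Y t \<xi>)\<^sup>2)) \<and>
     (\<forall>t s. (\<integral>\<xi>. X t \<xi> \<partial>M) = (\<integral>\<xi>. X s \<xi> \<partial>M)) \<and>
     (\<forall>t s. (\<integral>\<xi>. Y t \<xi> \<partial>M) = (\<integral>\<xi>. Y s \<xi> \<partial>M)) \<and>
     (\<forall>\<tau> t s. (\<integral>\<xi>. X t \<xi> * X (t + \<tau>) \<xi> \<partial>M) = (\<integral>\<xi>. X s \<xi> * X (s + \<tau>) \<xi> \<partial>M)) \<and>
     (\<forall>\<tau> t s. (\<integral>\<xi>. Y t \<xi> * Y (t + \<tau>) \<xi> \<partial>M) = (\<integral>\<xi>. Y s \<xi> * Y (s + \<tau>) \<xi> \<partial>M)) \<and>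
     (\<forall>\<tau> t s. (\<integral>\<xi>. X t \<xi> * Y (t + \<tau>) \<xi> \<partial>M) = (\<integral>\<xi>. X s \<xi> * Y (s + \<tau>) \<xi> \<partial>M))"

text \<open>
  For jointly wide-sense stationary processes \<open>E[X(t) Y(t + \<tau>)]\<close> does not depend on \<open>t\<close>;
  it is evaluated at \<open>t = 0\<close>.
\<close>

definition cross_cov ::
    "'a measure \<Rightarrow> (int \<Rightarrow> 'a \<Rightarrow> real) \<Rightarrow> (int \<Rightarrow> 'a \<Rightarrow> real) \<Rightarrow> int \<Rightarrow> real" where
  "cross_cov M X Y \<tau> = (\<integral>\<xi>. X 0 \<xi> * Y \<tau> \<xi> \<partial>M)"

text \<open>
  The two-sided series \<open>\<Sum>\<^sub>\<tau> R(\<tau>) z\<^sup>-\<^sup>\<tau>\<close> is summed symmetrically, and need not converge absolutely.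
\<close>

definition zeta_partial :: "(int \<Rightarrow> real) \<Rightarrow> complex \<Rightarrow> nat \<Rightarrow> complex" where
  "zeta_partial R z n = (\<Sum>\<tau> = - int n..int n. of_real (R \<tau>) * z powi (- \<tau>))"

definition zeta_transform :: "(int \<Rightarrow> real) \<Rightarrow> complex \<Rightarrow> complex" where
  "zeta_transform R z = lim (zeta_partial R z)"

definition cross_psd ::
    "'a measure \<Rightarrow> (int \<Rightarrow> 'a \<Rightarrow> real) \<Rightarrow> (int \<Rightarrow> 'a \<Rightarrow> real) \<Rightarrow> real \<Rightarrow> complex" where
  "cross_psd M X Y \<omega> = zeta_transform (cross_cov M X Y) (cis \<omega>)"

text \<open>
  The autocovariance is even, so the symmetric partial sums for \<open>\<Phi>\<^sub>X\<^sub>X\<close> on the unit circle are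
  real; taking the real part only changes the type.
\<close>

definition psd :: "'a measure \<Rightarrow> (int \<Rightarrow> 'a \<Rightarrow> real) \<Rightarrow> real \<Rightarrow> real" where
  "psd M X \<omega> = Re (cross_psd M X X \<omega>)"

text \<open>
  The spectral density exists as a function if the defining series converges at almost every
  frequency and its sum is an integrable density for the covariance, i.e. the inverse transform
  \<open>R(\<tau>) = 1/(2\<pi>) \<integral> \<Phi>(\<omega>) e\<^sup>i\<^sup>\<omega>\<^sup>\<tau> d\<omega>\<close> holds. The latter excludes a singular (for instance discrete)
  part of the spectrum, which would make the density a measure rather than a function; both
  properties are automatic when the covariance is absolutely summable.
\<close>

definition has_cross_psd ::
    "'a measure \<Rightarrow> (int \<Rightarrow> 'a \<Rightarrow> real) \<Rightarrow> (int \<Rightarrow> 'a \<Rightarrow> real) \<Rightarrow> bool" where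
  "has_cross_psd M X Y \<longleftrightarrow>
     (AE \<omega> in lborel. \<omega> \<in> {-pi..pi} \<longrightarrow> convergent (zeta_partial (cross_cov M X Y) (cis \<omega>))) \<and>
     set_integrable lborel {-pi..pi} (cross_psd M X Y) \<and>
     (\<forall>\<tau>. complex_of_real (cross_cov M X Y \<tau>) =
        of_real (1 / (2 * pi)) *
          (LINT \<omega>:{-pi..pi}|lborel. cross_psd M X Y \<omega> * cis (of_int \<tau> * \<omega>)))"

definition coherence ::
    "'a measure \<Rightarrow> (int \<Rightarrow> 'a \<Rightarrow> real) \<Rightarrow> (int \<Rightarrow> 'a \<Rightarrow> real) \<Rightarrow> real \<Rightarrow> real" where
  "coherence M X Y \<omega> = (cmod (cross_psd M Y X \<omega>))\<^sup>2 / (psd M X \<omega> * psd M Y \<omega>)"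

definition coh_dist ::
    "'a measure \<Rightarrow> (int \<Rightarrow> 'a \<Rightarrow> real) \<Rightarrow> (int \<Rightarrow> 'a \<Rightarrow> real) \<Rightarrow> real" where
  "coh_dist M X Y =
     sqrt (1 / (2 * pi) * (LINT \<omega>:{-pi..pi}|lborel. 1 - coherence M X Y \<omega>))"

text \<open>
  \<open>Y\<close> is the output of a linear time-invariant, possibly non-causal, filter with input \<open>X\<close>:
  at every time, \<open>Y\<close> is the mean-square limit of the outputs of one sequence of
  finite-impulse-response filters, the \<open>n\<close>-th having impulse response \<open>h n\<close> on the taps \<open>S n\<close>.
\<close>

definition linear_filtering ::
    "'a measure \<Rightarrow> (int \<Rightarrow> 'a \<Rightarrow> real) \<Rightarrow> (int \<Rightarrow> 'a \<Rightarrow> real) \<Rightarrow> bool" where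
  "linear_filtering M X Y \<longleftrightarrow>
     (\<exists>(S :: nat \<Rightarrow> int set) (h :: nat \<Rightarrow> int \<Rightarrow> real). (\<forall>n. finite (S n)) \<and>
        (\<forall>t. (\<lambda>n. \<integral>\<xi>. (Y t \<xi> - (\<Sum>s\<in>S n. h n s * X (t - s) \<xi>))\<^sup>2 \<partial>M) \<longlonglongrightarrow> 0))"

text \<open>
  The coherence does not change when a process is passed through an invertible linear filter: the
  distance from \<open>X\<close> to \<open>2 X\<close>, or to a time shift of \<open>X\<close>, is \<open>0\<close>. Processes that are linear
  filterings of each other are therefore identified.
\<close>

definition filter_equiv ::
    "'a measure \<Rightarrow> (int \<Rightarrow> 'a \<Rightarrow> real) set \<Rightarrow> ((int \<Rightarrow> 'a \<Rightarrow> real) \<times> (int \<Rightarrow> 'a \<Rightarrow> real)) set" where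
  "filter_equiv M P =
     {(x, y). x \<in> P \<and> y \<in> P \<and> linear_filtering M x y \<and> linear_filtering M y x}"

end

theory Submission
  imports Defs
begin

text \<open>
  At a frequency where all series converge, a quadratic form of the spectral matrix is the limit of
  its own symmetric partial sums. Their Cesaro means are the numbers
  \<open>1/n E|\<Sum>\<^sub>X \<Sum>\<^sub>s\<^sub><\<^sub>n a\<^sub>X e\<^sup>i\<^sup>s\<^sup>\<omega> X(s)|\<^sup>2 \<ge> 0\<close>, so the spectral matrix is positive semidefinite. It is thus a
  Gram matrix, and \<open>sqrt (1 - C\<^sub>X\<^sub>Y)\<close> is the sine of the angle between two lines, which satisfies the
  triangle inequality at each frequency; Minkowski's inequality in \<open>L\<^sup>2\<close> integrates it.

  A finite filter \<open>H\<close> has mean square error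
  \<open>1/(2\<pi>) \<integral> \<Phi>\<^sub>Y (1 - C\<^sub>X\<^sub>Y) + \<Phi>\<^sub>X |W - H|\<^sup>2 d\<omega>\<close>, where \<open>W\<close> is the Wiener filter. Hence \<open>Y\<close> is a filtering
  of \<open>X\<close> only if \<open>C\<^sub>X\<^sub>Y = 1\<close> almost everywhere; the converse holds because trigonometric polynomials
  are dense in \<open>L\<^sup>2(\<Phi>\<^sub>X d\<omega>)\<close>. So distance zero coincides with being filterings of each other.
\<close>

subsection \<open>Positive semidefinite kernels\<close>

text \<open>Let \<open>a\<close>, \<open>b\<close>, \<open>c\<close> be the cosines of angles
  \<alpha>, \<beta>, \<gamma> in [0, pi/2]. The last hypothesis reads cos(\<alpha> + \<beta>) \<le>
  cos \<gamma>, that is \<gamma> \<le> \<alpha> + \<beta>, and the sine is subadditive on such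
  angles.\<close>

lemma sine_triangle:
  fixes a b c :: real
  assumes "0 \<le> a" "a \<le> 1" "0 \<le> b" "b \<le> 1" "0 \<le> c" "c \<le> 1"
    and "a * b - sqrt (1 - a\<^sup>2) * sqrt (1 - b\<^sup>2) \<le> c"
  shows "sqrt (1 - c\<^sup>2) \<le> sqrt (1 - a\<^sup>2) + sqrt (1 - b\<^sup>2)"
proof -
  define s t where "s = sqrt (1 - a\<^sup>2)" and "t = sqrt (1 - b\<^sup>2)"
  have s: "s \<ge> 0" "s\<^sup>2 = 1 - a\<^sup>2" and t: "t \<ge> 0" "t\<^sup>2 = 1 - b\<^sup>2"
    using assms by (auto simp: s_def t_def power_le_one)
  have c: "a * b - s * t \<le> c" using assms(7) by (simp add: s_def t_def)
  have "1 - c\<^sup>2 \<le> (s + t)\<^sup>2"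
  proof (cases "s * t \<le> a * b")
    \<comment> \<open>Here \<alpha> + \<beta> \<le> pi/2, so sin \<gamma> \<le> sin(\<alpha> +
      \<beta>) = \<open>s * b + a * t\<close>, where both cosines are at most 1.\<close>
    case True
    have "(a * b - s * t)\<^sup>2 \<le> c\<^sup>2" using True c by (intro power_mono) auto
    moreover have "1 - (a * b - s * t)\<^sup>2 = (s * b + a * t)\<^sup>2"
    proof -
      have "(a * b - s * t)\<^sup>2 + (s * b + a * t)\<^sup>2 = (a\<^sup>2 + s\<^sup>2) * (b\<^sup>2 + t\<^sup>2)"
        by (simp add: power2_eq_square algebra_simps)
      then show ?thesis using s t by simp
    qed
    moreover have "(s * b + a * t)\<^sup>2 \<le> (s + t)\<^sup>2"
      using assms s t by (intro power_mono add_mono mult_left_le mult_left_le_one_le) auto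
    ultimately show ?thesis by linarith
  next
    \<comment> \<open>Beyond a right angle the squared sines of \<alpha> and \<beta> already add up
      to at least 1.\<close>
    case False
    then have "(a * b)\<^sup>2 \<le> (s * t)\<^sup>2" using assms by (intro power_mono) auto
    also have "(s * t)\<^sup>2 = (1 - a\<^sup>2) * (1 - b\<^sup>2)" using s t by (simp add: power_mult_distrib)
    finally have "1 \<le> s\<^sup>2 + t\<^sup>2" using s t by (simp add: power_mult_distrib algebra_simps)
    moreover have "s\<^sup>2 + t\<^sup>2 \<le> (s + t)\<^sup>2" using s t by (simp add: power2_sum)
    ultimately show ?thesis by (smt (verit) zero_le_power2)
  qed
  then have "sqrt (1 - c\<^sup>2) \<le> sqrt ((s + t)\<^sup>2)" by (rule real_sqrt_le_mono)
  then show ?thesis using s t by (simp add: s_def t_def)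
qed

lemma nonneg_form_imp_det_nonneg:
  fixes p q :: real and r :: complex
  assumes "\<And>a c. 0 \<le> (cmod a)\<^sup>2 * p + (cmod c)\<^sup>2 * q + 2 * Re (a * cnj c * r)"
  shows "(cmod r)\<^sup>2 \<le> p * q"
proof -
  have p: "0 \<le> p" using assms[of 1 0] by simp
  \<comment> \<open>The test vector (\<open>- t * cnj r\<close>, 1) aligns the phase of the cross
    term and leaves a quadratic in the real number \<open>t\<close>.\<close>
  have *: "0 \<le> t\<^sup>2 * (cmod r)\<^sup>2 * p + q - 2 * t * (cmod r)\<^sup>2" for t :: real
  proof -
    have "cnj r * r = of_real ((cmod r)\<^sup>2)" using complex_norm_square[of r] by (simp add: mult.commute)
    then have "Re (- of_real t * cnj r * cnj 1 * r) = - t * (cmod r)\<^sup>2"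
      by (simp add: mult.assoc)
    then show ?thesis using assms[of "- of_real t * cnj r" 1]
      by (simp add: norm_mult power_mult_distrib)
  qed
  show ?thesis
  proof (cases "p = 0")
    case True
    show ?thesis
    proof (cases "r = 0")
      case False
      \<comment> \<open>For \<open>p = 0\<close> the quadratic degenerates to a linear function of
        \<open>t\<close>; this \<open>t\<close> would give it the value -1.\<close>
      then have "2 * ((q + 1) / (2 * (cmod r)\<^sup>2)) * (cmod r)\<^sup>2 = q + 1" by simp
      with *[of "(q + 1) / (2 * (cmod r)\<^sup>2)"] True show ?thesis by simp
    qed (use True in simp)
  next
    case False
    \<comment> \<open>\<open>t = 1 / p\<close> is the minimizer of the quadratic.\<close>
    have "(1 / p)\<^sup>2 * (cmod r)\<^sup>2 * p + q - 2 * (1 / p) * (cmod r)\<^sup>2 = q - (cmod r)\<^sup>2 / p"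
      using False by (simp add: power2_eq_square field_simps)
    with *[of "1 / p"] have "(cmod r)\<^sup>2 / p \<le> q" by simp
    then show ?thesis using False p by (simp add: field_simps)
  qed
qed

text \<open>The algebraic form of a Gram matrix. Hermitian symmetry makes the quadratic form real,
  so \<open>Re\<close> only adapts the type.\<close>

definition positive_kernel :: "'i set \<Rightarrow> ('i \<Rightarrow> 'i \<Rightarrow> complex) \<Rightarrow> bool" where
  "positive_kernel I G \<longleftrightarrow>
     (\<forall>p\<in>I. \<forall>q\<in>I. G q p = cnj (G p q)) \<and>
     (\<forall>a. 0 \<le> Re (\<Sum>p\<in>I. \<Sum>q\<in>I. a p * cnj (a q) * G p q))"

text \<open>For a Gram matrix this is the squared cosine of the angle between the lines spanned by
  the vectors of \<open>x\<close> and \<open>y\<close>.\<close>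

definition kernel_coherence :: "('i \<Rightarrow> 'i \<Rightarrow> complex) \<Rightarrow> 'i \<Rightarrow> 'i \<Rightarrow> real" where
  "kernel_coherence G x y = (cmod (G x y))\<^sup>2 / (Re (G x x) * Re (G y y))"

lemma kernel_hermitian:
  assumes "positive_kernel I G" "p \<in> I" "q \<in> I" shows "G q p = cnj (G p q)"
  using assms unfolding positive_kernel_def by blast

lemma kernel_nonneg:
  assumes "positive_kernel I G" shows "0 \<le> Re (\<Sum>p\<in>I. \<Sum>q\<in>I. a p * cnj (a q) * G p q)"
  by (rule assms[unfolded positive_kernel_def, THEN conjunct2, THEN spec])

lemma kernel_diag:
  assumes "positive_kernel I G" "x \<in> I" shows "G x x = of_real (Re (G x x))"
  using kernel_hermitian[OF assms(1,2,2)] by (simp add: complex_eq_iff)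

lemma kernel_norm_commute:
  assumes "positive_kernel I G" "x \<in> I" "y \<in> I" shows "cmod (G y x) = cmod (G x y)"
  using kernel_hermitian[OF assms] by simp

lemma kernel_coherence_self:
  assumes "positive_kernel I G" "x \<in> I" "Re (G x x) > 0"
  shows "kernel_coherence G x x = 1"
proof -
  have "cmod (G x x) = Re (G x x)"
    using arg_cong[OF kernel_diag[OF assms(1,2)], of cmod] assms(3) by simp
  then show ?thesis using assms by (simp add: kernel_coherence_def power2_eq_square)
qed

lemma kernel_Cauchy_Schwarz:
  assumes G: "positive_kernel {x, y} G"
  shows "(cmod (G x y))\<^sup>2 \<le> Re (G x x) * Re (G y y)"
\<comment> \<open>For \<open>x = y\<close> the index set is a singleton and the form has one term
  only; the bound is then an equality because the diagonal is real.\<close>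
proof (cases "x = y")
  case True
  then show ?thesis using arg_cong[OF kernel_diag[OF G, of x], of cmod] by (simp add: power2_eq_square)
next
  case False
  show ?thesis
  proof (rule nonneg_form_imp_det_nonneg)
    fix a c
    have h: "G y x = cnj (G x y)" by (rule kernel_hermitian[OF G]) auto
    have d: "Im (G x x) = 0" "Im (G y y) = 0"
      using arg_cong[OF kernel_diag[OF G], of _ Im] by auto
    have "0 \<le> Re (\<Sum>p\<in>{x,y}. \<Sum>q\<in>{x,y}. (if p = x then a else c) * cnj (if q = x then a else c) * G p q)"
      by (rule kernel_nonneg[OF G])
    also have "\<dots> = (cmod a)\<^sup>2 * Re (G x x) + (cmod c)\<^sup>2 * Re (G y y) + 2 * Re (a * cnj c * G x y)"
      using False unfolding cmod_power2 unfolding power2_eq_square by (simp add: h d algebra_simps)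
    finally show "0 \<le> \<dots>" .
  qed
qed

text \<open>Coefficients on \<open>I\<close> extend by zero to \<open>J\<close> without changing the
  form.\<close>

lemma positive_kernel_subset:
  assumes "positive_kernel J G" "I \<subseteq> J" "finite J" shows "positive_kernel I G"
  unfolding positive_kernel_def
proof (intro conjI allI ballI)
  fix a :: "'a \<Rightarrow> complex"
  let ?a = "\<lambda>p. if p \<in> I then a p else 0"
  have "0 \<le> Re (\<Sum>p\<in>J. \<Sum>q\<in>J. ?a p * cnj (?a q) * G p q)"
    by (rule kernel_nonneg[OF assms(1)])
  also have "(\<Sum>p\<in>J. \<Sum>q\<in>J. ?a p * cnj (?a q) * G p q) = (\<Sum>p\<in>I. \<Sum>q\<in>I. a p * cnj (a q) * G p q)"
    using assms by (intro sum.mono_neutral_cong_right) (auto intro!: sum.mono_neutral_cong_right)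
  finally show "0 \<le> Re \<dots>" .
next
  fix p q assume "p \<in> I" "q \<in> I"
  then show "G q p = cnj (G p q)" using assms(2) by (intro kernel_hermitian[OF assms(1)]) auto
qed

text \<open>Only the \<open>y\<close>-coefficient is eliminated from the form, leaving a two-dimensional one.\<close>

lemma kernel_Schur_complement:
  assumes G: "positive_kernel {x, y, z} G" and d: "x \<noteq> y" "y \<noteq> z" "x \<noteq> z" and y: "Re (G y y) > 0"
  shows "(cmod (G x z * G y y - G x y * G y z))\<^sup>2
    \<le> (Re (G x x) * Re (G y y) - (cmod (G x y))\<^sup>2) * (Re (G y y) * Re (G z z) - (cmod (G y z))\<^sup>2)"
proof (rule nonneg_form_imp_det_nonneg)
  fix a c
  define A B C where "A = Re (G x x)" and "B = Re (G y y)" and "C = Re (G z z)"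
  define u v w where "u = G x y" and "v = G y z" and "w = G x z"
  have diag: "G x x = of_real A" "G y y = of_real B" "G z z = of_real C"
    using kernel_diag[OF G] by (auto simp: A_def B_def C_def)
  have h: "G y x = cnj u" "G z y = cnj v" "G z x = cnj w"
    unfolding u_def v_def w_def by (rule kernel_hermitian[OF G]; simp)+
  \<comment> \<open>For given \<open>a\<close> and \<open>c\<close> this \<open>b\<close> minimizes
    the form; geometrically it projects the combination of \<open>x\<close> and \<open>z\<close>
    onto the orthogonal complement of \<open>y\<close>.\<close>
  define b where "b = - (a * u + c * cnj v) / of_real B"
  have B: "B > 0" using y by (simp add: B_def)
  have bB: "b * of_real B = - (a * u + c * cnj v)" using B by (simp add: b_def)
  have "0 \<le> Re (\<Sum>p\<in>{x,y,z}. \<Sum>q\<in>{x,y,z}.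
     (if p = x then a else if p = y then b else c) * cnj (if q = x then a else if q = y then b else c) * G p q)"
    by (rule kernel_nonneg[OF G])
  \<comment> \<open>The factor \<open>B\<close> clears the denominator of \<open>b\<close>, so that
    \<open>b\<close> enters only through \<open>b * of_real B\<close>.\<close>
  then have "0 \<le> B * \<dots>" using B by simp
  also have "\<dots> = Re (of_real B * (a * cnj a * A + c * cnj c * C + a * cnj c * w + c * cnj a * cnj w)
     + (b * of_real B) * cnj (a * u + c * cnj v) + cnj (b * of_real B) * (a * u + c * cnj v) + (b * of_real B) * cnj (b * of_real B))"
    using d by (simp add: h diag flip: u_def v_def w_def) (simp add: algebra_simps)
  also have "\<dots> = (cmod a)\<^sup>2 * (A * B - (cmod u)\<^sup>2) + (cmod c)\<^sup>2 * (B * C - (cmod v)\<^sup>2)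
     + 2 * Re (a * cnj c * (w * of_real B - u * v))"
    unfolding bB cmod_power2 unfolding power2_eq_square by (simp add: algebra_simps)
  finally show "0 \<le> (cmod a)\<^sup>2 * (Re (G x x) * Re (G y y) - (cmod (G x y))\<^sup>2)
     + (cmod c)\<^sup>2 * (Re (G y y) * Re (G z z) - (cmod (G y z))\<^sup>2)
     + 2 * Re (a * cnj c * (G x z * G y y - G x y * G y z))"
    by (simp add: diag A_def[symmetric] B_def[symmetric] C_def[symmetric] flip: u_def v_def w_def)
qed

lemma kernel_coherence_le_1:
  assumes "positive_kernel {x, y} G" "Re (G x x) > 0" "Re (G y y) > 0"
  shows "kernel_coherence G x y \<le> 1"
  using kernel_Cauchy_Schwarz[OF assms(1)] assms(2,3) by (simp add: kernel_coherence_def)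

text \<open>After normalization the Schur complement bounds the distance of the inner product of
  \<open>x\<close> and \<open>z\<close> from the product of the other two inner products by a
  product of two sines. This is the cosine addition inequality that \<open>sine_triangle\<close>
  expects.\<close>

lemma kernel_coherence_triangle:
  assumes G: "positive_kernel {x, y, z} G"
    and pos: "Re (G x x) > 0" "Re (G y y) > 0" "Re (G z z) > 0"
  shows "sqrt (1 - kernel_coherence G x z)
    \<le> sqrt (1 - kernel_coherence G x y) + sqrt (1 - kernel_coherence G y z)"
proof -
  have G2: "positive_kernel {p, q} G" if "p \<in> {x,y,z}" "q \<in> {x,y,z}" for p q
    by (rule positive_kernel_subset[OF G]) (use that in auto)
  have le1: "kernel_coherence G p q \<le> 1" if "p \<in> {x,y,z}" "q \<in> {x,y,z}" for p q
    by (rule kernel_coherence_le_1) (use G2[OF that] that pos in auto)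
  \<comment> \<open>The Schur complement needs three distinct indices; coinciding ones have
    coherence 1 and make one of the three sines vanish.\<close>
  consider "x = z" | "x = y" | "y = z" | "x \<noteq> y" "y \<noteq> z" "x \<noteq> z" by blast
  then show ?thesis
  proof cases
    case 1
    then show ?thesis using le1[of x y] le1[of y z] kernel_coherence_self[OF G _ pos(1)] by simp
  next
    case 2
    then show ?thesis using kernel_coherence_self[OF G _ pos(1)] by simp
  next
    case 3
    then show ?thesis using kernel_coherence_self[OF G _ pos(3)] by simp
  next
    case 4
    define A B C where "A = Re (G x x)" and "B = Re (G y y)" and "C = Re (G z z)"
    have ABC: "A > 0" "B > 0" "C > 0" using pos by (auto simp: A_def B_def C_def)
    \<comment> \<open>The cosines of the three angles between lines.\<close>
    define a b c where "a = cmod (G x y) / sqrt (A * B)" and "b = cmod (G y z) / sqrt (B * C)"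
      and "c = cmod (G x z) / sqrt (A * C)"
    have sq: "kernel_coherence G x y = a\<^sup>2" "kernel_coherence G y z = b\<^sup>2" "kernel_coherence G x z = c\<^sup>2"
      using ABC by (simp_all add: kernel_coherence_def a_def b_def c_def power_divide A_def B_def C_def)
    have nn: "0 \<le> a" "0 \<le> b" "0 \<le> c" using ABC by (auto simp: a_def b_def c_def)
    have 1: "a \<le> 1" "b \<le> 1" "c \<le> 1"
      using le1[of x y] le1[of y z] le1[of x z] nn unfolding sq by (auto simp: abs_square_le_1)
    have GB: "G y y = of_real B" using kernel_diag[OF G, of y] by (simp add: B_def)
    have "cmod (G x y * G y z) - cmod (G x z * G y y) \<le> cmod (G x z * G y y - G x y * G y z)"
      by (metis norm_minus_commute norm_triangle_ineq2)
    also have "\<dots> \<le> sqrt ((A * B - (cmod (G x y))\<^sup>2) * (B * C - (cmod (G y z))\<^sup>2))"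
      using kernel_Schur_complement[OF G 4] pos unfolding A_def B_def C_def
      by (intro real_le_rsqrt) auto
    also have "\<dots> = sqrt ((A * B) * (B * C)) * (sqrt (1 - a\<^sup>2) * sqrt (1 - b\<^sup>2))"
      using ABC by (simp add: a_def b_def power_divide real_sqrt_mult[symmetric] field_simps)
    also have "sqrt ((A * B) * (B * C)) = B * sqrt (A * C)"
      using ABC by (simp add: real_sqrt_mult)
    finally have "a * b - c \<le> sqrt (1 - a\<^sup>2) * sqrt (1 - b\<^sup>2)"
      using ABC by (simp add: a_def b_def c_def norm_mult GB real_sqrt_mult field_simps)
    then show ?thesis using sine_triangle[OF nn(1) 1(1) nn(2) 1(2) nn(3) 1(3)] unfolding sq by simp
  qed
qed

section \<open>Minkowski's inequality for square-integrable functions\<close>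

text \<open>For positive weights, (f + g)^2 \<le> (1 + b/a) f^2 + (1 + a/b) g^2. When
  \<open>a\<close> and \<open>b\<close> are the two norms, the right side integrates to (a +
  b)^2.\<close>

lemma sqrt_integral_square_triangle:
  fixes f g h :: "'a \<Rightarrow> real"
  assumes f: "integrable M (\<lambda>x. (f x)\<^sup>2)" and g: "integrable M (\<lambda>x. (g x)\<^sup>2)"
    and h: "integrable M (\<lambda>x. (h x)\<^sup>2)"
    and le: "AE x in M. 0 \<le> h x \<and> h x \<le> f x + g x"
  shows "sqrt (\<integral>x. (h x)\<^sup>2 \<partial>M) \<le> sqrt (\<integral>x. (f x)\<^sup>2 \<partial>M) + sqrt (\<integral>x. (g x)\<^sup>2 \<partial>M)"
proof -
  define A B where "A = sqrt (\<integral>x. (f x)\<^sup>2 \<partial>M)" and "B = sqrt (\<integral>x. (g x)\<^sup>2 \<partial>M)"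
  have nn: "A \<ge> 0" "B \<ge> 0" by (auto simp: A_def B_def)
  have A: "(\<integral>x. (f x)\<^sup>2 \<partial>M) = A\<^sup>2" and B: "(\<integral>x. (g x)\<^sup>2 \<partial>M) = B\<^sup>2"
    by (auto simp: A_def B_def)
  \<comment> \<open>Either norm may vanish, and both serve as denominators; they are therefore
    enlarged by an arbitrary \<open>e > 0\<close>.\<close>
  have le_e: "sqrt (\<integral>x. (h x)\<^sup>2 \<partial>M) \<le> (A + e) + (B + e)" if e: "e > 0" for e
  proof -
    define a b where "a = A + e" and "b = B + e"
    have ab: "a > 0" "b > 0" "A\<^sup>2 \<le> a\<^sup>2" "B\<^sup>2 \<le> b\<^sup>2" using e nn by (auto simp: a_def b_def intro!: power_mono)
    have "(\<integral>x. (h x)\<^sup>2 \<partial>M) \<le> (\<integral>x. (1 + b / a) * (f x)\<^sup>2 + (1 + a / b) * (g x)\<^sup>2 \<partial>M)"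
    proof (rule integral_mono_AE)
      show "AE x in M. (h x)\<^sup>2 \<le> (1 + b / a) * (f x)\<^sup>2 + (1 + a / b) * (g x)\<^sup>2"
        using le
      proof eventually_elim
        case (elim x)
        then have "(h x)\<^sup>2 \<le> (f x + g x)\<^sup>2" by (intro power_mono) auto
        moreover have "(1 + b / a) * (f x)\<^sup>2 + (1 + a / b) * (g x)\<^sup>2 - (f x + g x)\<^sup>2
           = (b * f x - a * g x)\<^sup>2 / (a * b)"
          using ab by (simp add: power2_eq_square field_simps)
        moreover have "(b * f x - a * g x)\<^sup>2 / (a * b) \<ge> 0" using ab by simp
        ultimately show ?case by linarith
      qed
    qed (use f g h in auto)
    also have "\<dots> = (1 + b / a) * A\<^sup>2 + (1 + a / b) * B\<^sup>2"
      using f g by (simp add: A B)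
    also have "\<dots> \<le> (1 + b / a) * a\<^sup>2 + (1 + a / b) * b\<^sup>2"
      using ab by (intro add_mono mult_left_mono) auto
    also have "\<dots> = (a + b)\<^sup>2" using ab by (simp add: power2_eq_square field_simps)
    finally show ?thesis using ab by (intro real_le_lsqrt) (auto simp: a_def b_def)
  qed
  have "sqrt (\<integral>x. (h x)\<^sup>2 \<partial>M) \<le> A + B + d" if "d > 0" for d
    using le_e[of "d / 2"] that by simp
  then show ?thesis unfolding A_def B_def by (rule field_le_epsilon)
qed

subsection \<open>Density of trigonometric polynomials\<close>

definition trig_sum :: "int set \<Rightarrow> (int \<Rightarrow> complex) \<Rightarrow> real \<Rightarrow> complex" where
  "trig_sum S h \<omega> = (\<Sum>s\<in>S. h s * cis (of_int s * \<omega>))"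

definition trig_poly :: "(real \<Rightarrow> complex) \<Rightarrow> bool" where
  "trig_poly f \<longleftrightarrow> (\<exists>S h. finite S \<and> f = trig_sum S h)"

lemma trig_poly_monomial: "trig_poly (\<lambda>\<omega>. c * cis (of_int s * \<omega>))"
  unfolding trig_poly_def
  by (rule exI[of _ "{s}"], rule exI[of _ "\<lambda>_. c"]) (simp add: trig_sum_def fun_eq_iff)

lemma trig_poly_const: "trig_poly (\<lambda>\<omega>. c)"
  using trig_poly_monomial[of c 0] by simp

lemma trig_poly_add:
  assumes "trig_poly f" "trig_poly g" shows "trig_poly (\<lambda>\<omega>. f \<omega> + g \<omega>)"
proof -
  obtain S h where S: "finite S" "f = trig_sum S h" using assms(1) by (auto simp: trig_poly_def)
  obtain T k where T: "finite T" "g = trig_sum T k" using assms(2) by (auto simp: trig_poly_def)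
  let ?l = "\<lambda>s. (if s \<in> S then h s else 0) + (if s \<in> T then k s else 0)"
  have "f \<omega> + g \<omega> = trig_sum (S \<union> T) ?l \<omega>" for \<omega>
  proof -
    have "f \<omega> = (\<Sum>s\<in>S \<union> T. (if s \<in> S then h s else 0) * cis (of_int s * \<omega>))"
      unfolding S(2) trig_sum_def using S(1) T(1) by (intro sum.mono_neutral_cong_left) auto
    moreover have "g \<omega> = (\<Sum>s\<in>S \<union> T. (if s \<in> T then k s else 0) * cis (of_int s * \<omega>))"
      unfolding T(2) trig_sum_def using S(1) T(1) by (intro sum.mono_neutral_cong_left) auto
    ultimately show ?thesis by (simp add: trig_sum_def sum.distrib distrib_right)
  qed
  then show ?thesis unfolding trig_poly_def using S(1) T(1) by blast
qed

lemma trig_poly_sum: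
  assumes "finite I" "\<And>i. i \<in> I \<Longrightarrow> trig_poly (f i)"
  shows "trig_poly (\<lambda>\<omega>. \<Sum>i\<in>I. f i \<omega>)"
  using assms by (induction I rule: finite_induct) (auto intro: trig_poly_const trig_poly_add)

lemma trig_poly_mult:
  assumes "trig_poly f" "trig_poly g" shows "trig_poly (\<lambda>\<omega>. f \<omega> * g \<omega>)"
proof -
  obtain S h where S: "finite S" "f = trig_sum S h" using assms(1) by (auto simp: trig_poly_def)
  obtain T k where T: "finite T" "g = trig_sum T k" using assms(2) by (auto simp: trig_poly_def)
  have "f \<omega> * g \<omega> = (\<Sum>s\<in>S. \<Sum>t\<in>T. h s * k t * cis (of_int (s + t) * \<omega>))" for \<omega>
    unfolding S T trig_sum_def sum_product of_int_add distrib_right cis_mult[symmetric] by (simp add: mult_ac)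
  then show ?thesis by (simp add: trig_poly_sum trig_poly_monomial S(1) T(1) del: of_int_add)
qed

lemma trig_poly_continuous: "trig_poly f \<Longrightarrow> continuous_on UNIV f"
  by (auto simp: trig_poly_def trig_sum_def intro!: continuous_intros)

text \<open>Stone-Weierstrass yields polynomials in the coordinates of the plane. On the unit circle
  the coordinates are cos and sin, hence trigonometric polynomials, and these are closed under sums
  and products.\<close>

lemma trig_poly_real_polynomial:
  fixes p :: "complex \<Rightarrow> real"
  assumes "real_polynomial_function p"
  shows "trig_poly (\<lambda>\<omega>. of_real (p (cis \<omega>)))"
  using assms
proof induction
  case (linear f)
  interpret bounded_linear f by fact
  \<comment> \<open>Euler's formulas for cos and sin, weighted by the values of the linear map at 1
    and at the imaginary unit.\<close>
  have "complex_of_real (f (cis \<omega>)) =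
     (of_real (f 1) / 2 + of_real (f \<i>) / (2 * \<i>)) * cis (of_int 1 * \<omega>) +
     (of_real (f 1) / 2 - of_real (f \<i>) / (2 * \<i>)) * cis (of_int (-1) * \<omega>)" for \<omega>
  proof -
    have "cis \<omega> = cos \<omega> *\<^sub>R 1 + sin \<omega> *\<^sub>R \<i>" by (simp add: complex_eq_iff)
    then have "f (cis \<omega>) = cos \<omega> * f 1 + sin \<omega> * f \<i>" by (metis add scaleR real_scaleR_def)
    then show ?thesis by (simp add: complex_eq_iff Re_divide Im_divide)
  qed
  then show ?case by (simp add: trig_poly_add trig_poly_monomial del: of_int_minus of_int_1 of_int_numeral)
next
  case (const c)
  show ?case by (rule trig_poly_const)
next
  case (add f g)
  then show ?case using trig_poly_add by fastforce
next
  case (mult f g)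
  then show ?case using trig_poly_mult by fastforce
qed

lemma trig_poly_polynomial:
  fixes p :: "complex \<Rightarrow> complex"
  assumes "polynomial_function p"
  shows "trig_poly (\<lambda>\<omega>. p (cis \<omega>))"
proof -
  have "real_polynomial_function (Re \<circ> p)" "real_polynomial_function (Im \<circ> p)"
    using assms bounded_linear_Re bounded_linear_Im unfolding polynomial_function_def by blast+
  then have "trig_poly (\<lambda>\<omega>. of_real ((Re \<circ> p) (cis \<omega>)) + \<i> * of_real ((Im \<circ> p) (cis \<omega>)))"
    by (intro trig_poly_add trig_poly_mult trig_poly_const trig_poly_real_polynomial)
  then show ?thesis by (simp flip: complex_eq)
qed

section \<open>Trigonometric approximation in L2 of a measure on the circle\<close>

text \<open>The intended measure is \<Phi>_X d\<omega>. Absolute continuity carries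
  almost-everywhere limits over from Lebesgue measure; the open interval identifies frequencies with
  points of the circle other than -1.\<close>

locale circle_measure = finite_measure \<mu> for \<mu> :: "real measure" +
  assumes sets_eq [measurable_cong]: "sets \<mu> = sets borel"
    and abs_cont: "absolutely_continuous lborel \<mu>"
    and AE_circle: "AE \<omega> in \<mu>. \<omega> \<in> {-pi<..<pi}"
begin

text \<open>The squared L2 distance, with values in \<open>ennreal\<close> so that it is meaningful
  before any integrability is known.\<close>

definition l2_dist :: "(real \<Rightarrow> complex) \<Rightarrow> (real \<Rightarrow> complex) \<Rightarrow> ennreal" where
  "l2_dist f g = (\<integral>\<^sup>+\<omega>. ennreal ((cmod (f \<omega> - g \<omega>))\<^sup>2) \<partial>\<mu>)"

definition trig_approximable :: "(real \<Rightarrow> complex) \<Rightarrow> bool" where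
  "trig_approximable f \<longleftrightarrow> (\<forall>e>0. \<exists>H. trig_poly H \<and> l2_dist f H < ennreal e)"

lemma trig_approximable_close:
  assumes f [measurable]: "f \<in> borel_measurable borel"
    and "\<And>e. e > 0 \<Longrightarrow> \<exists>g. g \<in> borel_measurable borel \<and> trig_approximable g \<and> l2_dist f g < ennreal e"
  shows "trig_approximable f"
  unfolding trig_approximable_def
proof (intro allI impI)
  fix e :: real assume "e > 0"
  \<comment> \<open>Since |x + y|^2 \<le> 2 |x|^2 + 2 |y|^2, two errors of \<open>e / 4\<close> add
    up to \<open>e\<close>.\<close>
  then have "e / 4 > 0" by simp
  from assms(2)[OF this] obtain g where g [measurable]: "g \<in> borel_measurable borel"
    and ga: "trig_approximable g" and fg: "l2_dist f g < ennreal (e / 4)" by blast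
  obtain H where H: "trig_poly H" and gH: "l2_dist g H < ennreal (e / 4)"
    using ga \<open>e / 4 > 0\<close> unfolding trig_approximable_def by blast
  have [measurable]: "H \<in> borel_measurable borel"
    by (rule borel_measurable_continuous_onI[OF trig_poly_continuous[OF H]])
  have "l2_dist f H \<le> (\<integral>\<^sup>+\<omega>. 2 * ennreal ((cmod (f \<omega> - g \<omega>))\<^sup>2) + 2 * ennreal ((cmod (g \<omega> - H \<omega>))\<^sup>2) \<partial>\<mu>)"
    unfolding l2_dist_def
  proof (rule nn_integral_mono)
    fix \<omega>
    have "(cmod (f \<omega> - H \<omega>))\<^sup>2 \<le> (cmod (f \<omega> - g \<omega>) + cmod (g \<omega> - H \<omega>))\<^sup>2"
      using norm_triangle_ineq[of "f \<omega> - g \<omega>" "g \<omega> - H \<omega>"] by (intro power_mono) auto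
    also have "\<dots> \<le> 2 * (cmod (f \<omega> - g \<omega>))\<^sup>2 + 2 * (cmod (g \<omega> - H \<omega>))\<^sup>2"
      using sum_squares_bound[of "cmod (f \<omega> - g \<omega>)" "cmod (g \<omega> - H \<omega>)"] by (simp add: power2_sum)
    finally show "ennreal ((cmod (f \<omega> - H \<omega>))\<^sup>2) \<le> 2 * ennreal ((cmod (f \<omega> - g \<omega>))\<^sup>2) + 2 * ennreal ((cmod (g \<omega> - H \<omega>))\<^sup>2)"
      by (simp add: ennreal_leI flip: ennreal_plus ennreal_numeral ennreal_mult)
  qed
  also have "\<dots> = 2 * l2_dist f g + 2 * l2_dist g H"
    unfolding l2_dist_def by (simp add: nn_integral_add nn_integral_cmult)
  also have "\<dots> < 2 * ennreal (e / 4) + 2 * ennreal (e / 4)"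
    by (intro add_strict_mono ennreal_mult_strict_left_mono fg gH) auto
  also have "\<dots> = ennreal e"
    using \<open>e > 0\<close> by (simp flip: ennreal_plus ennreal_numeral ennreal_mult)
  finally show "\<exists>H. trig_poly H \<and> l2_dist f H < ennreal e" using H by blast
qed

text \<open>Dominated convergence turns pointwise limits into L2 limits. Each enlargement of the
  class below, from continuous functions on the circle to all of L2, is one application.\<close>

lemma trig_approximable_limit:
  fixes f :: "real \<Rightarrow> complex" and g :: "nat \<Rightarrow> real \<Rightarrow> complex" and w :: "real \<Rightarrow> real"
  assumes [measurable]: "f \<in> borel_measurable borel" "\<And>n. g n \<in> borel_measurable borel"
      "w \<in> borel_measurable borel"
    and ga: "\<And>n. trig_approximable (g n)"
    and le: "\<And>n \<omega>. cmod (g n \<omega>) \<le> w \<omega>" and w: "(\<integral>\<^sup>+\<omega>. ennreal ((w \<omega>)\<^sup>2) \<partial>\<mu>) < \<infinity>"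
    and lim: "AE \<omega> in \<mu>. (\<lambda>n. g n \<omega>) \<longlonglongrightarrow> f \<omega>"
  shows "trig_approximable f"
proof (rule trig_approximable_close)
  fix e :: real assume "e > 0"
  have "(\<lambda>n. l2_dist f (g n)) \<longlonglongrightarrow> (\<integral>\<^sup>+\<omega>. 0 \<partial>\<mu>)"
    unfolding l2_dist_def
  proof (rule nn_integral_dominated_convergence)
    \<comment> \<open>Both \<open>f\<close> and \<open>g n\<close> are bounded by \<open>w\<close>,
      so their difference is at most \<open>2 * w\<close>; squaring gives the 4.\<close>
    show "(\<integral>\<^sup>+\<omega>. 4 * ennreal ((w \<omega>)\<^sup>2) \<partial>\<mu>) < \<infinity>"
      using w by (simp add: nn_integral_cmult ennreal_mult_less_top)
    show "AE \<omega> in \<mu>. ennreal ((cmod (f \<omega> - g n \<omega>))\<^sup>2) \<le> 4 * ennreal ((w \<omega>)\<^sup>2)" for n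
      using lim
    proof eventually_elim
      case (elim \<omega>)
      have "cmod (f \<omega>) \<le> w \<omega>"
        by (rule tendsto_upperbound[OF tendsto_norm[OF elim]]) (auto simp: le)
      then have "cmod (f \<omega> - g n \<omega>) \<le> 2 * w \<omega>"
        using norm_triangle_ineq4[of "f \<omega>" "g n \<omega>"] le[of n \<omega>] by simp
      then have "(cmod (f \<omega> - g n \<omega>))\<^sup>2 \<le> (2 * w \<omega>)\<^sup>2" by (intro power_mono) auto
      then show ?case by (simp add: ennreal_leI power_mult_distrib flip: ennreal_numeral ennreal_mult)
    qed
    show "AE \<omega> in \<mu>. (\<lambda>n. ennreal ((cmod (f \<omega> - g n \<omega>))\<^sup>2)) \<longlonglongrightarrow> 0"
      using lim
    proof eventually_elim
      case (elim \<omega>)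
      have "(\<lambda>n. (cmod (f \<omega> - g n \<omega>))\<^sup>2) \<longlonglongrightarrow> (cmod (f \<omega> - f \<omega>))\<^sup>2"
        by (intro tendsto_intros elim)
      then show ?case using tendsto_ennrealI by fastforce
    qed
  qed measurable
  then have "\<forall>\<^sub>F n in sequentially. l2_dist f (g n) < ennreal e"
    using \<open>e > 0\<close> by (intro order_tendstoD(2)) auto
  then obtain n where "l2_dist f (g n) < ennreal e" by (auto simp: eventually_sequentially)
  then show "\<exists>g. g \<in> borel_measurable borel \<and> trig_approximable g \<and> l2_dist f g < ennreal e"
    using ga by (intro exI[of _ "g n"]) auto
qed measurable

lemma trig_approximable_continuous_circle:
  fixes G :: "complex \<Rightarrow> complex"
  assumes G: "continuous_on (sphere 0 1) G"
  shows "trig_approximable (\<lambda>\<omega>. G (cis \<omega>))"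
  unfolding trig_approximable_def
proof (intro allI impI)
  fix e :: real assume e: "e > 0"
  define m where "m = measure \<mu> (space \<mu>)"
  have m: "m \<ge> 0" "emeasure \<mu> (space \<mu>) = ennreal m" by (auto simp: m_def emeasure_eq_measure)
  \<comment> \<open>A uniform error \<open>d\<close> costs at most \<open>d\<^sup>2 * m\<close> in
    squared L2 distance. The summand 1 keeps the quotient defined for \<open>m = 0\<close> and the
    final inequality strict.\<close>
  define d where "d = sqrt (e / (m + 1))"
  have d: "d > 0" "d\<^sup>2 = e / (m + 1)" using e m by (auto simp: d_def)
  obtain p where p: "polynomial_function p" "\<And>z. z \<in> sphere 0 1 \<Longrightarrow> cmod (G z - p z) < d"
    using Stone_Weierstrass_polynomial_function[OF compact_sphere G d(1)] by blast
  have "l2_dist (\<lambda>\<omega>. G (cis \<omega>)) (\<lambda>\<omega>. p (cis \<omega>)) \<le> (\<integral>\<^sup>+\<omega>. ennreal (d\<^sup>2) \<partial>\<mu>)"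
    unfolding l2_dist_def using p(2)
    by (intro nn_integral_mono ennreal_leI power_mono[OF less_imp_le]) auto
  also have "\<dots> = ennreal (d\<^sup>2 * m)" using m by (simp add: ennreal_mult)
  also have "\<dots> < ennreal e"
    using e m unfolding d by (intro ennreal_lessI) (auto simp: field_simps)
  finally show "\<exists>H. trig_poly H \<and> l2_dist (\<lambda>\<omega>. G (cis \<omega>)) H < ennreal e"
    using trig_poly_polynomial[OF p(1)] by blast
qed

text \<open>On the circle \<open>g\<close> becomes \<open>g (Arg z)\<close>, which may jump at -1.
  Multiplying by a cutoff that vanishes at -1 restores continuity, and the cutoffs increase to 1 at
  every other point.\<close>

lemma trig_approximable_bounded_continuous:
  fixes g :: "real \<Rightarrow> complex"
  assumes g: "continuous_on UNIV g" and K: "\<And>x. cmod (g x) \<le> K"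
  shows "trig_approximable g"
proof -
  define \<kappa> :: "nat \<Rightarrow> complex \<Rightarrow> real" where "\<kappa> n z = min 1 (real n * cmod (z + 1))" for n z
  define G where "G n z = of_real (\<kappa> n z) * g (Arg z)" for n z
  have [measurable]: "g \<in> borel_measurable borel" by (rule borel_measurable_continuous_onI[OF g])
  have \<kappa>: "0 \<le> \<kappa> n z" "\<kappa> n z \<le> 1" "\<kappa> n z \<le> real n * cmod (z + 1)" for n z by (auto simp: \<kappa>_def)
  have K0: "0 \<le> K" using K[of 0] norm_ge_zero order_trans by blast
  have cont: "continuous_on (sphere 0 1) (G n)" for n
    unfolding continuous_on_eq_continuous_within
  proof
    fix z :: complex assume z: "z \<in> sphere 0 1"
    have "isCont (G n) z"
    proof (cases "z = -1")
      case True
      \<comment> \<open>At -1 the branch cut of \<open>Arg\<close> is harmless: \<open>g\<close> is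
        bounded by \<open>K\<close> and the cutoff tends to 0.\<close>
      have "((\<lambda>z. real n * cmod (z + 1) * K) \<longlongrightarrow> real n * cmod (-1 + 1) * K) (at (-1))"
        by (intro tendsto_intros)
      then have "((\<lambda>z. real n * cmod (z + 1) * K) \<longlongrightarrow> 0) (at (-1))" by simp
      then have "(G n \<longlongrightarrow> 0) (at (-1))"
      proof (rule Lim_null_comparison[rotated], intro always_eventually allI)
        fix z show "cmod (G n z) \<le> real n * cmod (z + 1) * K"
          using \<kappa>[of n z] K[of "Arg z"] K0 by (auto simp: G_def norm_mult intro!: mult_mono)
      qed
      then show ?thesis by (simp add: True isCont_def) (simp add: G_def \<kappa>_def)
    next
      case False
      have "z \<notin> \<real>\<^sub>\<le>\<^sub>0"
      proof
        assume "z \<in> \<real>\<^sub>\<le>\<^sub>0"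
        then obtain r where "z = of_real r" "r \<le> 0" by (auto elim: nonpos_Reals_cases)
        then show False using z False by auto
      qed
      then have "isCont (\<lambda>z. g (Arg z)) z"
        using g by (intro isCont_o2[OF continuous_at_Arg]) (auto simp: continuous_on_eq_continuous_at)
      then show ?thesis unfolding G_def \<kappa>_def by (intro continuous_intros) auto
    qed
    then show "continuous (at z within sphere 0 1) (G n)"
      by (rule continuous_at_imp_continuous_at_within)
  qed
  have Gb [measurable]: "(\<lambda>\<omega>. G n (cis \<omega>)) \<in> borel_measurable borel" for n
    by (rule borel_measurable_continuous_onI)
       (auto intro!: continuous_on_compose2[OF cont] continuous_intros)
  show ?thesis
  proof (rule trig_approximable_limit[where w = "\<lambda>_. K"])
    show "trig_approximable (\<lambda>\<omega>. G n (cis \<omega>))" for n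
      by (rule trig_approximable_continuous_circle[OF cont])
    show "cmod (G n (cis \<omega>)) \<le> K" for n \<omega>
      using \<kappa>[of n "cis \<omega>"] K[of "Arg (cis \<omega>)"] K0
        mult_mono[of "\<kappa> n (cis \<omega>)" 1 "cmod (g (Arg (cis \<omega>)))" K] by (simp add: G_def norm_mult)
    show "AE \<omega> in \<mu>. (\<lambda>n. G n (cis \<omega>)) \<longlonglongrightarrow> g \<omega>"
      using AE_circle
    proof eventually_elim
      case (elim \<omega>)
      then have Arg: "Arg (cis \<omega>) = \<omega>" by (intro Arg_cis) auto
      have "cis \<omega> + 1 \<noteq> 0"
      proof
        assume "cis \<omega> + 1 = 0"
        then have "cis \<omega> = -1" by (simp add: add_eq_0_iff2)
        then have "Arg (cis \<omega>) = Arg (cis pi)" by simp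
        also have "\<dots> = pi" by (rule Arg_cis) auto
        finally show False using Arg elim by simp
      qed
      then have "filterlim (\<lambda>n. real n * cmod (cis \<omega> + 1)) at_top sequentially"
        by (intro filterlim_at_top_mult_tendsto_pos[OF tendsto_const] filterlim_real_sequentially) auto
      then have "\<forall>\<^sub>F n in sequentially. 1 \<le> real n * cmod (cis \<omega> + 1)"
        by (simp add: filterlim_at_top)
      then have "\<forall>\<^sub>F n in sequentially. G n (cis \<omega>) = g \<omega>"
        by eventually_elim (simp add: G_def \<kappa>_def Arg)
      then show ?case by (rule tendsto_eventually)
    qed
  qed (auto simp: less_top[symmetric] ennreal_mult_eq_top_iff)
qed

text \<open>A measurable function is an almost-everywhere limit of continuous functions.\<close>

lemma trig_approximable_bounded:
  fixes f :: "real \<Rightarrow> complex"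
  assumes f [measurable]: "f \<in> borel_measurable borel" and K: "\<And>x. cmod (f x) \<le> K"
  shows "trig_approximable f"
proof -
  have K0: "0 \<le> K" using K[of 0] norm_ge_zero order_trans by blast
  have "f \<in> borel_measurable lebesgue" by (rule measurable_completion) simp
  then have "f measurable_on UNIV" by (intro lebesgue_measurable_imp_measurable_on) auto
  then obtain N g where N: "negligible N" and g: "\<And>n. continuous_on UNIV (g n)"
    and lim: "\<And>x. x \<notin> N \<Longrightarrow> (\<lambda>n. g n x) \<longlonglongrightarrow> f x"
    by (auto simp: measurable_on_def)
  \<comment> \<open>The approximants \<open>g n\<close> need not be bounded. Projecting them onto
    the ball of radius \<open>K\<close> is continuous, fixes the values of \<open>f\<close>, and
    supplies the dominating constant.\<close>
  let ?c = "closest_point (cball (0::complex) K)"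
  have c: "continuous_on T ?c" for T using K0 by (intro continuous_on_closest_point) auto
  have g': "continuous_on UNIV (\<lambda>x. ?c (g n x))" for n
    by (rule continuous_on_compose2[OF c g]) auto
  have [measurable]: "(\<lambda>x. ?c (g n x)) \<in> borel_measurable borel" for n
    by (rule borel_measurable_continuous_onI[OF g'])
  have b: "cmod (?c z) \<le> K" for z
    using closest_point_in_set[of "cball (0::complex) K" z] K0 by auto
  have "AE x in lebesgue. x \<notin> N" using N by (simp add: negligible_iff_null_sets AE_not_in)
  then have "AE x in lborel. x \<notin> N" by (simp add: AE_completion_iff)
  then have N': "AE x in \<mu>. x \<notin> N"
    by (intro absolutely_continuous_AE[OF _ abs_cont]) (auto simp: sets_eq)
  show ?thesis
  proof (rule trig_approximable_limit[where w = "\<lambda>_. K"])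
    show "AE x in \<mu>. (\<lambda>n. ?c (g n x)) \<longlonglongrightarrow> f x"
      using N'
    proof eventually_elim
      case (elim x)
      have "(\<lambda>n. ?c (g n x)) \<longlonglongrightarrow> ?c (f x)"
        using c[of UNIV] lim[OF elim] by (intro isCont_tendsto_compose[of _ ?c]) (auto simp: continuous_on_eq_continuous_at)
      then show ?case using K[of x] by (simp add: closest_point_self)
    qed
  qed (use b in \<open>auto simp: less_top[symmetric] ennreal_mult_eq_top_iff intro!: trig_approximable_bounded_continuous[OF g' b]\<close>)
qed

text \<open>The truncations of \<open>f\<close> at height \<open>n\<close> are bounded, converge to
  \<open>f\<close> pointwise, and are dominated by |f|.\<close>

theorem trig_approximable_L2:
  fixes f :: "real \<Rightarrow> complex"
  assumes f [measurable]: "f \<in> borel_measurable borel"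
    and fin: "(\<integral>\<^sup>+\<omega>. ennreal ((cmod (f \<omega>))\<^sup>2) \<partial>\<mu>) < \<infinity>"
  shows "trig_approximable f"
proof (rule trig_approximable_limit[where w = "\<lambda>\<omega>. cmod (f \<omega>)"])
  let ?g = "\<lambda>(n::nat) \<omega>. if cmod (f \<omega>) \<le> real n then f \<omega> else 0"
  show "trig_approximable (?g n)" for n
    by (rule trig_approximable_bounded[where K = "real n"]) auto
  show "AE \<omega> in \<mu>. (\<lambda>n. ?g n \<omega>) \<longlonglongrightarrow> f \<omega>"
  proof (rule AE_I2, rule tendsto_eventually)
    fix \<omega>
    obtain m :: nat where "cmod (f \<omega>) \<le> real m" using real_arch_simple by blast
    then have "?g n \<omega> = f \<omega>" if "n \<ge> m" for n using that by auto
    then show "\<forall>\<^sub>F n in sequentially. ?g n \<omega> = f \<omega>" unfolding eventually_sequentially by blast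
  qed
qed (use fin in auto)

end

subsection \<open>Spectral matrices of stationary processes\<close>

lemma integrable_mult_square_integrable:
  fixes f g :: "'a \<Rightarrow> real"
  assumes [measurable]: "f \<in> borel_measurable M" "g \<in> borel_measurable M"
    and "integrable M (\<lambda>x. (f x)\<^sup>2)" "integrable M (\<lambda>x. (g x)\<^sup>2)"
  shows "integrable M (\<lambda>x. f x * g x)"
proof (rule Bochner_Integration.integrable_bound)
  show "integrable M (\<lambda>x. (f x)\<^sup>2 + (g x)\<^sup>2)" using assms by auto
  have "\<bar>f x * g x\<bar> \<le> (f x)\<^sup>2 + (g x)\<^sup>2" for x
  proof -
    have "2 * (\<bar>f x\<bar> * \<bar>g x\<bar>) \<le> (f x)\<^sup>2 + (g x)\<^sup>2"
      using sum_squares_bound[of "\<bar>f x\<bar>" "\<bar>g x\<bar>"] by (simp add: mult.assoc)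
    moreover have "0 \<le> \<bar>f x\<bar> * \<bar>g x\<bar>" by simp
    ultimately show ?thesis unfolding abs_mult by linarith
  qed
  then show "AE x in M. norm (f x * g x) \<le> norm ((f x)\<^sup>2 + (g x)\<^sup>2)" by simp
qed simp

text \<open>The second moment of a linear combination is the quadratic form of the covariances. It
  gives both the positivity of the spectral matrix and the error of a finite filter.\<close>

lemma integral_norm_sum_square:
  fixes Z :: "'k \<Rightarrow> 'a \<Rightarrow> real" and c :: "'k \<Rightarrow> complex"
  assumes "finite K"
    and Z: "\<And>k. k \<in> K \<Longrightarrow> Z k \<in> borel_measurable M" "\<And>k. k \<in> K \<Longrightarrow> integrable M (\<lambda>x. (Z k x)\<^sup>2)"
  shows "integrable M (\<lambda>x. (cmod (\<Sum>k\<in>K. c k * of_real (Z k x)))\<^sup>2)"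
    and "(\<integral>x. (cmod (\<Sum>k\<in>K. c k * of_real (Z k x)))\<^sup>2 \<partial>M) =
      Re (\<Sum>k\<in>K. \<Sum>l\<in>K. c k * cnj (c l) * of_real (\<integral>x. Z k x * Z l x \<partial>M))"
proof -
  have int: "integrable M (\<lambda>x. Z k x * Z l x)" if "k \<in> K" "l \<in> K" for k l
    using that Z by (intro integrable_mult_square_integrable) auto
  have eq: "(cmod (\<Sum>k\<in>K. c k * of_real (Z k x)))\<^sup>2 =
      Re (\<Sum>k\<in>K. \<Sum>l\<in>K. c k * cnj (c l) * of_real (Z k x * Z l x))" for x
  proof -
    have "complex_of_real ((cmod (\<Sum>k\<in>K. c k * of_real (Z k x)))\<^sup>2) =
        (\<Sum>k\<in>K. \<Sum>l\<in>K. c k * cnj (c l) * of_real (Z k x * Z l x))"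
      unfolding complex_norm_square cnj_sum sum_product by (simp add: mult_ac)
    then show ?thesis by (metis Re_complex_of_real)
  qed
  have int2: "integrable M (\<lambda>x. \<Sum>k\<in>K. \<Sum>l\<in>K. c k * cnj (c l) * complex_of_real (Z k x * Z l x))"
    by (intro Bochner_Integration.integrable_sum integrable_mult_right integrable_of_real int)
  show "integrable M (\<lambda>x. (cmod (\<Sum>k\<in>K. c k * of_real (Z k x)))\<^sup>2)"
    unfolding eq by (rule integrable_Re[OF int2])
  show "(\<integral>x. (cmod (\<Sum>k\<in>K. c k * of_real (Z k x)))\<^sup>2 \<partial>M) =
      Re (\<Sum>k\<in>K. \<Sum>l\<in>K. c k * cnj (c l) * of_real (\<integral>x. Z k x * Z l x \<partial>M))"
    unfolding eq integral_Re[OF int2]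
  proof (rule arg_cong[where f = Re])
    have "(\<integral>x. (\<Sum>k\<in>K. \<Sum>l\<in>K. c k * cnj (c l) * complex_of_real (Z k x * Z l x)) \<partial>M) =
        (\<Sum>k\<in>K. \<integral>x. (\<Sum>l\<in>K. c k * cnj (c l) * complex_of_real (Z k x * Z l x)) \<partial>M)"
      by (intro Bochner_Integration.integral_sum Bochner_Integration.integrable_sum integrable_mult_right integrable_of_real int)
    also have "\<dots> = (\<Sum>k\<in>K. \<Sum>l\<in>K. \<integral>x. c k * cnj (c l) * complex_of_real (Z k x * Z l x) \<partial>M)"
      by (intro sum.cong refl Bochner_Integration.integral_sum integrable_mult_right integrable_of_real int)
    finally show "(\<integral>x. (\<Sum>k\<in>K. \<Sum>l\<in>K. c k * cnj (c l) * complex_of_real (Z k x * Z l x)) \<partial>M) =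
        (\<Sum>k\<in>K. \<Sum>l\<in>K. c k * cnj (c l) * of_real (\<integral>x. Z k x * Z l x \<partial>M))"
      by (simp del: of_real_mult)
  qed
qed

text \<open>The Cesaro sums of the symmetric partial sums of a two-sided series are Toeplitz sums.\<close>

lemma sum_Toeplitz:
  fixes f :: "int \<Rightarrow> 'b::ab_group_add"
  shows "(\<Sum>s<n. \<Sum>t<n. f (int t - int s)) = (\<Sum>m<n. \<Sum>\<tau> = - int m..int m. f \<tau>)"
proof (induction n)
  case (Suc n)
  \<comment> \<open>Enlarging the square by one adds a column with differences 1 to n, a row with
    differences -n to -1, and the corner 0: one full symmetric range.\<close>
  have 1: "(\<Sum>s<n. f (int n - int s)) = (\<Sum>\<tau>\<in>{1..int n}. f \<tau>)"
    by (rule sum.reindex_bij_witness[of _ "\<lambda>\<tau>. nat (int n - \<tau>)" "\<lambda>s. int n - int s"]) auto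
  have 2: "(\<Sum>t<n. f (int t - int n)) = (\<Sum>\<tau>\<in>{- int n..-1}. f \<tau>)"
    by (rule sum.reindex_bij_witness[of _ "\<lambda>\<tau>. nat (\<tau> + int n)" "\<lambda>t. int t - int n"]) auto
  have "{- int n..int n} = {- int n..-1} \<union> ({0} \<union> {1..int n})" by auto
  then have "(\<Sum>\<tau> = - int n..int n. f \<tau>) = (\<Sum>\<tau>\<in>{- int n..-1}. f \<tau>) + (f 0 + (\<Sum>\<tau>\<in>{1..int n}. f \<tau>))"
    by (simp add: sum.union_disjoint)
  then show ?case using Suc by (simp add: sum.distrib 1[symmetric] 2[symmetric] add_ac)
qed simp

text \<open>Terms that are eventually below half of a negative limit drive the partial sums to minus
  infinity.\<close>

lemma limit_nonneg_of_sums_nonneg: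
  fixes T :: "nat \<Rightarrow> real"
  assumes T: "T \<longlonglongrightarrow> L" and sums: "\<And>n. 0 \<le> (\<Sum>m<n. T m)"
  shows "0 \<le> L"
proof (rule ccontr)
  assume "\<not> 0 \<le> L"
  then have "\<forall>\<^sub>F m in sequentially. T m < L / 2" by (intro order_tendstoD(2)[OF T]) auto
  then obtain N where N: "\<And>m. m \<ge> N \<Longrightarrow> T m < L / 2" by (auto simp: eventually_sequentially)
  have *: "(\<Sum>m<N + k. T m) \<le> (\<Sum>m<N. T m) + real k * (L / 2)" for k
  proof (induction k)
    case (Suc k)
    then show ?case using N[of "N + k"] by (simp add: field_simps)
  qed simp
  \<comment> \<open>Enough terms below \<open>L / 2\<close> to outweigh the first
    \<open>N\<close>.\<close>
  obtain k where k: "real k > (\<Sum>m<N. T m) / (- L / 2)" using reals_Archimedean2 by blast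
  then have "(\<Sum>m<N. T m) + real k * (L / 2) < 0" using \<open>\<not> 0 \<le> L\<close> by (simp add: field_simps)
  with *[of k] sums[of "N + k"] show False by linarith
qed

abbreviation freq :: "real measure" where
  "freq \<equiv> restrict_space lborel {-pi..pi}"

lemma finite_measure_freq: "finite_measure freq"
  by (rule finite_measureI) (simp add: space_restrict_space emeasure_restrict_space emeasure_lborel_Icc_eq)

lemma AE_freq_iff: "(AE \<omega> in freq. Q \<omega>) \<longleftrightarrow> (AE \<omega> in lborel. \<omega> \<in> {-pi..pi} \<longrightarrow> Q \<omega>)"
  by (rule AE_restrict_space_iff) simp

lemma integrable_freq_iff:
  fixes f :: "real \<Rightarrow> 'b::{banach, second_countable_topology}"
  shows "integrable freq f \<longleftrightarrow> set_integrable lborel {-pi..pi} f"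
  unfolding set_integrable_def by (rule integrable_restrict_space) simp

lemma integral_freq_eq:
  fixes f :: "real \<Rightarrow> 'b::{banach, second_countable_topology}"
  shows "integral\<^sup>L freq f = (LINT \<omega>:{-pi..pi}|lborel. f \<omega>)"
  unfolding set_lebesgue_integral_def by (rule integral_restrict_space) simp

section \<open>The spectral matrix at almost every frequency\<close>

locale spectral_family =
  fixes M :: "'a measure" and P :: "(int \<Rightarrow> 'a \<Rightarrow> real) set"
  assumes wss: "X \<in> P \<Longrightarrow> Y \<in> P \<Longrightarrow> jointly_wss M X Y"
    and cross_psd: "X \<in> P \<Longrightarrow> Y \<in> P \<Longrightarrow> has_cross_psd M X Y"
    and psd_pos: "X \<in> P \<Longrightarrow> AE \<omega> in lborel. \<omega> \<in> {-pi..pi} \<longrightarrow> psd M X \<omega> > 0"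
begin

abbreviation "spec \<omega> X Y \<equiv> cross_psd M X Y \<omega>"

lemma process_measurable: "X \<in> P \<Longrightarrow> X t \<in> borel_measurable M"
  and process_square_integrable: "X \<in> P \<Longrightarrow> integrable M (\<lambda>\<xi>. (X t \<xi>)\<^sup>2)"
  using wss[of X X] unfolding jointly_wss_def by blast+

lemma expectation_mult:
  assumes "X \<in> P" "Y \<in> P"
  shows "(\<integral>\<xi>. X s \<xi> * Y t \<xi> \<partial>M) = cross_cov M X Y (t - s)"
proof -
  have "(\<integral>\<xi>. X s \<xi> * Y (s + (t - s)) \<xi> \<partial>M) = (\<integral>\<xi>. X 0 \<xi> * Y (0 + (t - s)) \<xi> \<partial>M)"
    using wss[OF assms] unfolding jointly_wss_def by blast
  then show ?thesis by (simp add: cross_cov_def)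
qed

lemma cross_cov_swap:
  assumes "X \<in> P" "Y \<in> P" shows "cross_cov M Y X \<tau> = cross_cov M X Y (- \<tau>)"
proof -
  have "cross_cov M Y X \<tau> = (\<integral>\<xi>. X \<tau> \<xi> * Y 0 \<xi> \<partial>M)" by (simp add: cross_cov_def mult.commute)
  then show ?thesis using expectation_mult[OF assms, of \<tau> 0] by simp
qed

lemma spec_integrable: "X \<in> P \<Longrightarrow> Y \<in> P \<Longrightarrow> integrable freq (\<lambda>\<omega>. spec \<omega> X Y)"
  using cross_psd[of X Y] by (simp add: has_cross_psd_def integrable_freq_iff)

lemma spec_integrable_cis:
  assumes "X \<in> P" "Y \<in> P" shows "integrable freq (\<lambda>\<omega>. spec \<omega> X Y * cis (of_int \<tau> * \<omega>))"
proof (rule Bochner_Integration.integrable_bound[OF spec_integrable[OF assms]])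
  have "(\<lambda>\<omega>. cis (of_int \<tau> * \<omega>)) \<in> borel_measurable freq"
    by (intro measurable_restrict_space1 borel_measurable_continuous_onI continuous_intros
          | simp add: borel_measurable_continuous_onI continuous_intros)+
  then show "(\<lambda>\<omega>. spec \<omega> X Y * cis (of_int \<tau> * \<omega>)) \<in> borel_measurable freq"
    using spec_integrable[OF assms] by measurable
qed (simp add: norm_mult)

lemma cross_cov_eq_integral:
  "X \<in> P \<Longrightarrow> Y \<in> P \<Longrightarrow>
    of_real (cross_cov M X Y \<tau>) = of_real (1 / (2 * pi)) * (\<integral>\<omega>. spec \<omega> X Y * cis (of_int \<tau> * \<omega>) \<partial>freq)"
  using cross_psd[of X Y] unfolding has_cross_psd_def integral_freq_eq by blast

lemma zeta_partial_cis:
  "zeta_partial R (cis \<omega>) n = (\<Sum>\<tau> = - int n..int n. of_real (R \<tau>) * cis (- of_int \<tau> * \<omega>))"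
  by (simp add: zeta_partial_def cis_power_int)

lemma zeta_partial_swap:
  assumes "X \<in> P" "Y \<in> P"
  shows "zeta_partial (cross_cov M Y X) (cis \<omega>) n = cnj (zeta_partial (cross_cov M X Y) (cis \<omega>) n)"
  unfolding zeta_partial_cis cross_cov_swap[OF assms] cnj_sum
  by (rule sum.reindex_bij_witness[of _ uminus uminus]) (auto simp: cis_cnj)

text \<open>The frequencies at which the spectral matrix of \<open>J\<close> can be treated by
  pointwise linear algebra. For finite \<open>J\<close> the exceptional set in [-pi, pi] is a finite
  union of null sets.\<close>

definition spectral_points :: "(int \<Rightarrow> 'a \<Rightarrow> real) set \<Rightarrow> real set" where
  "spectral_points J = {\<omega>. (\<forall>X\<in>J. \<forall>Y\<in>J. convergent (zeta_partial (cross_cov M X Y) (cis \<omega>))) \<and>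
     (\<forall>X\<in>J. psd M X \<omega> > 0)}"

lemma AE_spectral_points:
  assumes "finite J" "J \<subseteq> P" shows "AE \<omega> in freq. \<omega> \<in> spectral_points J"
proof -
  have "AE \<omega> in freq. \<forall>X\<in>J. \<forall>Y\<in>J. convergent (zeta_partial (cross_cov M X Y) (cis \<omega>))"
  proof (intro AE_finite_allI assms(1))
    fix X Y assume "X \<in> J" "Y \<in> J"
    then show "AE \<omega> in freq. convergent (zeta_partial (cross_cov M X Y) (cis \<omega>))"
      using cross_psd[of X Y] assms(2) unfolding has_cross_psd_def AE_freq_iff by blast
  qed
  moreover have "AE \<omega> in freq. \<forall>X\<in>J. psd M X \<omega> > 0"
    using assms psd_pos unfolding AE_freq_iff[symmetric] by (intro AE_finite_allI) auto
  ultimately show ?thesis unfolding spectral_points_def by eventually_elim auto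
qed

lemma spec_LIMSEQ:
  assumes "\<omega> \<in> spectral_points J" "X \<in> J" "Y \<in> J"
  shows "zeta_partial (cross_cov M X Y) (cis \<omega>) \<longlonglongrightarrow> spec \<omega> X Y"
  using assms unfolding spectral_points_def cross_psd_def zeta_transform_def
  by (simp add: convergent_LIMSEQ_iff)

text \<open>The form of a single symmetric partial sum may be negative; only the sums over
  \<open>m < n\<close> are second moments. This suffices for the sign of the limit.\<close>

lemma positive_kernel_spec:
  assumes J: "finite J" "J \<subseteq> P" and \<omega>: "\<omega> \<in> spectral_points J"
  shows "positive_kernel J (spec \<omega>)"
  unfolding positive_kernel_def
proof (intro conjI ballI allI)
  fix X Y assume XY: "X \<in> J" "Y \<in> J"
  then have "(\<lambda>n. cnj (zeta_partial (cross_cov M X Y) (cis \<omega>) n)) \<longlonglongrightarrow> cnj (spec \<omega> X Y)"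
    by (intro tendsto_cnj spec_LIMSEQ[OF \<omega>])
  moreover have "(\<lambda>n. cnj (zeta_partial (cross_cov M X Y) (cis \<omega>) n)) = zeta_partial (cross_cov M Y X) (cis \<omega>)"
    using zeta_partial_swap XY J(2) by fastforce
  ultimately show "spec \<omega> Y X = cnj (spec \<omega> X Y)"
    using spec_LIMSEQ[OF \<omega> XY(2,1)] LIMSEQ_unique by fastforce
next
  fix a :: "(int \<Rightarrow> 'a \<Rightarrow> real) \<Rightarrow> complex"
  let ?z = "\<lambda>X Y. zeta_partial (cross_cov M X Y) (cis \<omega>)"
  show "0 \<le> Re (\<Sum>X\<in>J. \<Sum>Y\<in>J. a X * cnj (a Y) * spec \<omega> X Y)"
  proof (rule limit_nonneg_of_sums_nonneg)
    show "(\<lambda>n. Re (\<Sum>X\<in>J. \<Sum>Y\<in>J. a X * cnj (a Y) * ?z X Y n)) \<longlonglongrightarrow>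
        Re (\<Sum>X\<in>J. \<Sum>Y\<in>J. a X * cnj (a Y) * spec \<omega> X Y)"
      by (intro tendsto_intros spec_LIMSEQ[OF \<omega>])
    fix n
    let ?c = "\<lambda>(X, s). a X * cis (of_int (int s) * \<omega>)"
    let ?Z = "\<lambda>(X, s) \<xi>. X (int s) \<xi>"
    \<comment> \<open>The second moment of the sum of a_X e^(is\<omega>) X(s) over all X in
      \<open>J\<close> and all times s < n.\<close>
    have "0 \<le> (\<integral>\<xi>. (cmod (\<Sum>k\<in>J \<times> {..<n}. ?c k * of_real (?Z k \<xi>)))\<^sup>2 \<partial>M)"
      by simp
    also have "\<dots> = Re (\<Sum>k\<in>J \<times> {..<n}. \<Sum>l\<in>J \<times> {..<n}. ?c k * cnj (?c l) * of_real (\<integral>\<xi>. ?Z k \<xi> * ?Z l \<xi> \<partial>M))"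
      using J by (intro integral_norm_sum_square) (auto intro: process_measurable process_square_integrable)
    also have "(\<Sum>k\<in>J \<times> {..<n}. \<Sum>l\<in>J \<times> {..<n}. ?c k * cnj (?c l) * of_real (\<integral>\<xi>. ?Z k \<xi> * ?Z l \<xi> \<partial>M)) =
        (\<Sum>X\<in>J. \<Sum>s<n. \<Sum>Y\<in>J. \<Sum>t<n. ?c (X, s) * cnj (?c (Y, t)) * of_real (\<integral>\<xi>. X (int s) \<xi> * Y (int t) \<xi> \<partial>M))"
      by (simp add: sum.cartesian_product')
    also have "\<dots> = (\<Sum>X\<in>J. \<Sum>Y\<in>J. \<Sum>s<n. \<Sum>t<n. ?c (X, s) * cnj (?c (Y, t)) * of_real (\<integral>\<xi>. X (int s) \<xi> * Y (int t) \<xi> \<partial>M))"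
      by (intro sum.cong refl sum.swap)
    also have "\<dots> = (\<Sum>X\<in>J. \<Sum>Y\<in>J. a X * cnj (a Y) *
        (\<Sum>s<n. \<Sum>t<n. of_real (cross_cov M X Y (int t - int s)) * cis (- of_int (int t - int s) * \<omega>)))"
    proof (intro sum.cong refl)
      fix X Y assume "X \<in> J" "Y \<in> J"
      then have XY: "X \<in> P" "Y \<in> P" using J by auto
      have "?c (X, s) * cnj (?c (Y, t)) * r = a X * cnj (a Y) * (r * cis (- of_int (int t - int s) * \<omega>))" for s t r
      proof -
        have e: "cis (of_int (int s) * \<omega>) * cnj (cis (of_int (int t) * \<omega>)) = cis (- of_int (int t - int s) * \<omega>)"
          unfolding cis_cnj cis_mult by (simp add: algebra_simps)
        show ?thesis unfolding prod.case complex_cnj_mult e[symmetric] by (simp only: mult_ac)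
      qed
      then show "(\<Sum>s<n. \<Sum>t<n. ?c (X, s) * cnj (?c (Y, t)) * of_real (\<integral>\<xi>. X (int s) \<xi> * Y (int t) \<xi> \<partial>M)) =
        a X * cnj (a Y) * (\<Sum>s<n. \<Sum>t<n. of_real (cross_cov M X Y (int t - int s)) * cis (- of_int (int t - int s) * \<omega>))"
        by (simp only: expectation_mult[OF XY] sum_distrib_left)
    qed
    \<comment> \<open>By stationarity the summand depends on t - s only, so the double sum over
      times is a Toeplitz sum.\<close>
    also have "\<dots> = (\<Sum>X\<in>J. \<Sum>Y\<in>J. a X * cnj (a Y) * (\<Sum>m<n. ?z X Y m))"
      unfolding zeta_partial_cis
      by (intro sum.cong refl arg_cong2[where f = times] sum_Toeplitz[where f = "\<lambda>\<tau>. of_real (R \<tau>) * cis (- of_int \<tau> * \<omega>)" for R])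
    also have "Re \<dots> = (\<Sum>m<n. Re (\<Sum>X\<in>J. \<Sum>Y\<in>J. a X * cnj (a Y) * ?z X Y m))"
      unfolding Re_sum[symmetric] sum_distrib_left
      by (subst (2) sum.swap, subst (1) sum.swap) (simp add: sum.swap[of _ "{..<n}" J])
    finally show "0 \<le> (\<Sum>m<n. Re (\<Sum>X\<in>J. \<Sum>Y\<in>J. a X * cnj (a Y) * ?z X Y m))" .
  qed
qed

section \<open>The mean square error of a finite filter\<close>

lemma spec_cis_has_integral:
  assumes "X \<in> P" "Y \<in> P"
  shows "has_bochner_integral freq (\<lambda>\<omega>. spec \<omega> X Y * cis (of_int \<tau> * \<omega>)) (of_real (2 * pi * cross_cov M X Y \<tau>))"
  unfolding has_bochner_integral_iff
  using spec_integrable_cis[OF assms] cross_cov_eq_integral[OF assms, of \<tau>] by simp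

text \<open>Each covariance in the expanded square is replaced by its spectral integral; the result
  is the same for all \<open>t\<close>. As E[X(t - s) Y(t)] pairs \<Phi>_XY with e^(is\<omega>), the
  filter enters as \<open>trig_sum S h\<close>, which for real \<open>h\<close> is the conjugate of
  the usual frequency response.\<close>

lemma filter_error_eq_integral:
  fixes h :: "int \<Rightarrow> complex"
  assumes XY: "X \<in> P" "Y \<in> P" and S: "finite S"
  defines "F \<equiv> \<lambda>\<omega>. Re (spec \<omega> Y Y - 2 * (trig_sum S h \<omega> * spec \<omega> X Y) + trig_sum S h \<omega> * cnj (trig_sum S h \<omega>) * spec \<omega> X X)"
  shows "integrable M (\<lambda>\<xi>. (cmod (of_real (Y t \<xi>) - (\<Sum>s\<in>S. h s * of_real (X (t - s) \<xi>))))\<^sup>2)" (is ?int)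
    and "integrable freq F"
    and "(\<integral>\<xi>. (cmod (of_real (Y t \<xi>) - (\<Sum>s\<in>S. h s * of_real (X (t - s) \<xi>))))\<^sup>2 \<partial>M) = 1 / (2 * pi) * (\<integral>\<omega>. F \<omega> \<partial>freq)" (is ?eq)
proof -
  \<comment> \<open>The error is one linear combination: \<open>None\<close> stands for Y(t) with
    coefficient 1, \<open>Some s\<close> for X(t - s) with coefficient \<open>- h s\<close>.\<close>
  define K where "K = insert None (Some ` S)"
  define c where "c = case_option 1 (\<lambda>s. - h s)"
  define Z where "Z = case_option (Y t) (\<lambda>s. X (t - s))"
  have K: "finite K" using S by (simp add: K_def)
  have sumK: "(\<Sum>k\<in>K. g k) = g None + (\<Sum>s\<in>S. g (Some s))" for g :: "int option \<Rightarrow> complex"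
    using S by (simp add: K_def sum.reindex)
  have Z: "Z k \<in> borel_measurable M" "integrable M (\<lambda>\<xi>. (Z k \<xi>)\<^sup>2)" for k
    using XY by (auto simp: Z_def process_measurable process_square_integrable split: option.split)
  have "(\<Sum>k\<in>K. c k * of_real (Z k \<xi>)) = of_real (Y t \<xi>) - (\<Sum>s\<in>S. h s * of_real (X (t - s) \<xi>))" for \<xi>
    unfolding sumK by (simp add: c_def Z_def sum_negf)
  note quad = integral_norm_sum_square[of K Z M c, OF K Z, unfolded this]
  show ?int by (rule quad(1))

  define a where "a s = complex_of_real (cross_cov M X Y s)" for s
  define b where "b s = complex_of_real (cross_cov M X X s)" for s
  have E1: "(\<integral>\<xi>. Y t \<xi> * Y t \<xi> \<partial>M) = cross_cov M Y Y 0"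
    using expectation_mult[OF XY(2,2), of t t] by simp
  have E2: "complex_of_real (\<integral>\<xi>. X (t - s) \<xi> * Y t \<xi> \<partial>M) = a s" for s
    using expectation_mult[OF XY, of "t - s" t] by (simp add: a_def)
  have E3: "complex_of_real (\<integral>\<xi>. Y t \<xi> * X (t - s) \<xi> \<partial>M) = a s" for s
    using E2[of s] by (simp add: mult.commute)
  have E4: "complex_of_real (\<integral>\<xi>. X (t - s) \<xi> * X (t - s') \<xi> \<partial>M) = b (s - s')" for s s'
    using expectation_mult[OF XY(1,1), of "t - s" "t - s'"] by (simp add: b_def)
  define A where "A = of_real (cross_cov M Y Y 0) - 2 * (\<Sum>s\<in>S. h s * a s) + (\<Sum>s\<in>S. \<Sum>s'\<in>S. h s * cnj (h s') * b (s - s'))"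
  have "Re (\<Sum>k\<in>K. \<Sum>l\<in>K. c k * cnj (c l) * of_real (\<integral>\<xi>. Z k \<xi> * Z l \<xi> \<partial>M)) = Re A"
  proof -
    have "(\<Sum>k\<in>K. \<Sum>l\<in>K. c k * cnj (c l) * of_real (\<integral>\<xi>. Z k \<xi> * Z l \<xi> \<partial>M)) =
       of_real (cross_cov M Y Y 0) - (\<Sum>s\<in>S. cnj (h s) * a s) - (\<Sum>s\<in>S. h s * a s)
         + (\<Sum>s\<in>S. \<Sum>s'\<in>S. h s * cnj (h s') * b (s - s'))"
      unfolding sumK c_def Z_def option.case E1 E2 E3 E4 by (simp add: sum.distrib sum_negf sum_subtractf)
    \<comment> \<open>The covariances are real, so the two cross terms have equal real parts and
      merge into the factor 2 of \<open>A\<close>.\<close>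
    moreover have "Re (\<Sum>s\<in>S. cnj (h s) * a s) = Re (\<Sum>s\<in>S. h s * a s)"
      by (simp add: a_def)
    ultimately show ?thesis by (simp add: A_def)
  qed
  then have err: "(\<integral>\<xi>. (cmod (of_real (Y t \<xi>) - (\<Sum>s\<in>S. h s * of_real (X (t - s) \<xi>))))\<^sup>2 \<partial>M) = Re A"
    by (simp only: quad(2))

  \<comment> \<open>The integrand \<open>F\<close> before taking real parts, expanded into terms
    with known integrals; the factor with frequency 0 is 1.\<close>
  let ?G = "\<lambda>\<omega>. spec \<omega> Y Y * cis (of_int 0 * \<omega>) - 2 * (\<Sum>s\<in>S. h s * (spec \<omega> X Y * cis (of_int s * \<omega>)))
      + (\<Sum>s\<in>S. \<Sum>s'\<in>S. h s * cnj (h s') * (spec \<omega> X X * cis (of_int (s - s') * \<omega>)))"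
  have "has_bochner_integral freq ?G
     (of_real (2 * pi * cross_cov M Y Y 0) - 2 * (\<Sum>s\<in>S. h s * of_real (2 * pi * cross_cov M X Y s))
      + (\<Sum>s\<in>S. \<Sum>s'\<in>S. h s * cnj (h s') * of_real (2 * pi * cross_cov M X X (s - s'))))"
    by (intro has_bochner_integral_add has_bochner_integral_diff has_bochner_integral_sum
        has_bochner_integral_mult_right spec_cis_has_integral XY)
  also have "(of_real (2 * pi * cross_cov M Y Y 0) - 2 * (\<Sum>s\<in>S. h s * of_real (2 * pi * cross_cov M X Y s))
      + (\<Sum>s\<in>S. \<Sum>s'\<in>S. h s * cnj (h s') * of_real (2 * pi * cross_cov M X X (s - s')))) = of_real (2 * pi) * A"
    by (simp add: A_def a_def b_def sum_distrib_left algebra_simps)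
  finally have G: "has_bochner_integral freq ?G (of_real (2 * pi) * A)" .
  have GF: "Re (?G \<omega>) = F \<omega>" for \<omega>
  proof -
    have 1: "trig_sum S h \<omega> * spec \<omega> X Y = (\<Sum>s\<in>S. h s * (spec \<omega> X Y * cis (of_int s * \<omega>)))"
      unfolding trig_sum_def sum_distrib_right by (simp only: mult_ac)
    have "cis (of_int (s - s') * \<omega>) = cis (of_int s * \<omega>) * cnj (cis (of_int s' * \<omega>))" for s s'
      unfolding cis_cnj cis_mult by (simp add: algebra_simps)
    then have 2: "trig_sum S h \<omega> * cnj (trig_sum S h \<omega>) * spec \<omega> X X =
        (\<Sum>s\<in>S. \<Sum>s'\<in>S. h s * cnj (h s') * (spec \<omega> X X * cis (of_int (s - s') * \<omega>)))"
      unfolding trig_sum_def cnj_sum sum_product unfolding sum_distrib_right complex_cnj_mult by (simp only: mult_ac)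
    show ?thesis unfolding F_def 1 2 by simp
  qed
  have "has_bochner_integral freq (\<lambda>\<omega>. Re (?G \<omega>)) (Re (of_real (2 * pi) * A))"
    by (rule has_bochner_integral_Re[OF G])
  then have "has_bochner_integral freq F (2 * pi * Re A)"
    unfolding GF by simp
  then show "integrable freq F" ?eq
    unfolding has_bochner_integral_iff err by auto
qed

lemma spec_diag: "X \<in> P \<Longrightarrow> \<omega> \<in> spectral_points {X, Y} \<Longrightarrow> Y \<in> P \<Longrightarrow> spec \<omega> X X = of_real (psd M X \<omega>)"
  using kernel_diag[OF positive_kernel_spec, of "{X, Y}"] by (simp add: psd_def)

text \<open>The arguments are exchanged because \<open>coherence M X Y\<close> is built from
  \<Phi>_YX.\<close>

lemma coherence_eq: "coherence M X Y \<omega> = kernel_coherence (spec \<omega>) Y X"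
  by (simp add: coherence_def kernel_coherence_def psd_def mult.commute)

lemma spectral_points_psd: "\<omega> \<in> spectral_points J \<Longrightarrow> X \<in> J \<Longrightarrow> Re (spec \<omega> X X) > 0"
  by (simp add: spectral_points_def psd_def)

lemma coherence_commute:
  assumes "X \<in> P" "Y \<in> P" "\<omega> \<in> spectral_points {X, Y}"
  shows "coherence M X Y \<omega> = coherence M Y X \<omega>"
  using kernel_norm_commute[OF positive_kernel_spec, of "{X, Y}" \<omega> X Y] assms
  by (simp add: coherence_def mult.commute)

lemma coherence_bounds:
  assumes "X \<in> P" "Y \<in> P" "\<omega> \<in> spectral_points {X, Y}"
  shows "0 \<le> coherence M X Y \<omega>" "coherence M X Y \<omega> \<le> 1"
proof -
  have "positive_kernel {Y, X} (spec \<omega>)"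
    using positive_kernel_spec[of "{X, Y}" \<omega>] assms by (simp add: insert_commute)
  then show "coherence M X Y \<omega> \<le> 1"
    unfolding coherence_eq by (rule kernel_coherence_le_1) (auto intro: spectral_points_psd[OF assms(3)])
  show "0 \<le> coherence M X Y \<omega>"
    using spectral_points_psd[OF assms(3)] by (simp add: coherence_def psd_def less_imp_le)
qed

text \<open>The square is completed around the Wiener filter \<open>\<Phi>\<^sub>Y\<^sub>X / \<Phi>\<^sub>X\<close>.\<close>

lemma filter_error_density:
  assumes XY: "X \<in> P" "Y \<in> P" and \<omega>: "\<omega> \<in> spectral_points {X, Y}"
  shows "Re (spec \<omega> Y Y - 2 * (H * spec \<omega> X Y) + H * cnj H * spec \<omega> X X) =
    psd M Y \<omega> * (1 - coherence M X Y \<omega>) + psd M X \<omega> * (cmod (spec \<omega> Y X / spec \<omega> X X - H))\<^sup>2"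
proof -
  define p q u where "p = psd M X \<omega>" and "q = psd M Y \<omega>" and "u = spec \<omega> Y X"
  have pos: "p > 0" "q > 0" using \<omega> by (auto simp: spectral_points_def p_def q_def)
  have G: "positive_kernel {X, Y} (spec \<omega>)" using positive_kernel_spec[OF _ _ \<omega>] XY by simp
  have eq: "spec \<omega> X X = of_real p" "spec \<omega> Y Y = of_real q" "spec \<omega> X Y = cnj u"
    using kernel_diag[OF G, of X] kernel_diag[OF G, of Y] kernel_hermitian[OF G, of Y X]
    by (auto simp: p_def q_def u_def psd_def)
  have "p * (cmod (u / of_real p - H))\<^sup>2 = p * Re ((u / of_real p - H) * cnj (u / of_real p - H))"
    by (simp only: complex_norm_square[symmetric] Re_complex_of_real)
  also have "\<dots> = (cmod u)\<^sup>2 / p - 2 * Re (H * cnj u) + p * Re (H * cnj H)"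
    unfolding cmod_power2 using pos by (simp add: power2_eq_square field_simps)
  finally have 1: "p * (cmod (u / of_real p - H))\<^sup>2 = (cmod u)\<^sup>2 / p - 2 * Re (H * cnj u) + p * Re (H * cnj H)" .
  have 2: "q * (1 - (cmod u)\<^sup>2 / (p * q)) = q - (cmod u)\<^sup>2 / p" using pos by (simp add: field_simps)
  have 3: "Re (of_real q - 2 * (H * cnj u) + H * cnj H * of_real p) = q - 2 * Re (H * cnj u) + p * Re (H * cnj H)"
    by (simp add: algebra_simps)
  show ?thesis
    unfolding eq coherence_def p_def[symmetric] q_def[symmetric] u_def[symmetric] 1 2 3 by simp
qed

lemma coherence_measurable:
  assumes "X \<in> P" "Y \<in> P" shows "coherence M X Y \<in> borel_measurable freq"
proof -
  have [measurable]: "(\<lambda>\<omega>. spec \<omega> X X) \<in> borel_measurable freq" "(\<lambda>\<omega>. spec \<omega> Y Y) \<in> borel_measurable freq"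
    "(\<lambda>\<omega>. spec \<omega> Y X) \<in> borel_measurable freq"
    by (rule borel_measurable_integrable[OF spec_integrable], fact, fact)+
  show ?thesis unfolding coherence_def psd_def by measurable
qed

lemma psd_integrable: "X \<in> P \<Longrightarrow> integrable freq (psd M X)"
  unfolding psd_def by (intro integrable_Re spec_integrable)

lemma integrable_one_minus_coherence:
  assumes "X \<in> P" "Y \<in> P" shows "integrable freq (\<lambda>\<omega>. 1 - coherence M X Y \<omega>)"
proof (rule Bochner_Integration.integrable_bound)
  show "integrable freq (\<lambda>\<omega>. 1 :: real)" using finite_measure.integrable_const[OF finite_measure_freq] .
  have "AE \<omega> in freq. \<omega> \<in> spectral_points {X, Y}" using assms by (intro AE_spectral_points) auto
  then show "AE \<omega> in freq. norm (1 - coherence M X Y \<omega>) \<le> norm (1::real)"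
  proof eventually_elim
    case (elim \<omega>)
    then show ?case using coherence_bounds[OF assms elim] by simp
  qed
qed (use coherence_measurable[OF assms] in measurable)

lemma integrable_psd_one_minus_coherence:
  assumes "X \<in> P" "Y \<in> P" shows "integrable freq (\<lambda>\<omega>. psd M Y \<omega> * (1 - coherence M X Y \<omega>))"
proof (rule Bochner_Integration.integrable_bound[OF psd_integrable[OF assms(2)]])
  have "AE \<omega> in freq. \<omega> \<in> spectral_points {X, Y}" using assms by (intro AE_spectral_points) auto
  then show "AE \<omega> in freq. norm (psd M Y \<omega> * (1 - coherence M X Y \<omega>)) \<le> norm (psd M Y \<omega>)"
  proof eventually_elim
    case (elim \<omega>)
    then show ?case using coherence_bounds[OF assms elim] by (simp add: abs_mult mult_left_le)
  qed
qed (use coherence_measurable[OF assms] psd_integrable[OF assms(2)] in measurable)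

section \<open>Linear filtering and full coherence\<close>

text \<open>By the completed square, every finite filter has an error of at least 1/(2 pi) times the
  integral of \<Phi>_Y (1 - C). This bound does not depend on the filter, so errors tending to 0
  force it to be 0.\<close>

lemma coherence_1_if_filtering:
  assumes XY: "X \<in> P" "Y \<in> P" and filt: "linear_filtering M X Y"
  shows "AE \<omega> in freq. coherence M X Y \<omega> = 1"
proof -
  have AE: "AE \<omega> in freq. \<omega> \<in> spectral_points {X, Y}" using XY by (intro AE_spectral_points) auto
  let ?g = "\<lambda>\<omega>. psd M Y \<omega> * (1 - coherence M X Y \<omega>)"
  obtain S h where S: "\<And>n::nat. finite (S n)"
    and lim: "\<And>t. (\<lambda>n. \<integral>\<xi>. (Y t \<xi> - (\<Sum>s\<in>S n. h n s * X (t - s) \<xi>))\<^sup>2 \<partial>M) \<longlonglongrightarrow> 0"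
    using filt unfolding linear_filtering_def by blast
  have le: "1 / (2 * pi) * (\<integral>\<omega>. ?g \<omega> \<partial>freq) \<le> (\<integral>\<xi>. (Y 0 \<xi> - (\<Sum>s\<in>S n. h n s * X (0 - s) \<xi>))\<^sup>2 \<partial>M)" for n
  proof -
    let ?h = "\<lambda>s. complex_of_real (h n s)"
    note err = filter_error_eq_integral[OF XY S[of n], where h = ?h]
    have "(Y 0 \<xi> - (\<Sum>s\<in>S n. h n s * X (0 - s) \<xi>))\<^sup>2 =
        (cmod (of_real (Y 0 \<xi>) - (\<Sum>s\<in>S n. ?h s * of_real (X (0 - s) \<xi>))))\<^sup>2" for \<xi>
      by (simp flip: of_real_mult of_real_sum of_real_diff)
    then have eq: "(\<integral>\<xi>. (Y 0 \<xi> - (\<Sum>s\<in>S n. h n s * X (0 - s) \<xi>))\<^sup>2 \<partial>M) =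
        (\<integral>\<xi>. (cmod (of_real (Y 0 \<xi>) - (\<Sum>s\<in>S n. ?h s * of_real (X (0 - s) \<xi>))))\<^sup>2 \<partial>M)" by simp
    show ?thesis unfolding eq err(3)
    proof (intro mult_left_mono integral_mono_AE integrable_psd_one_minus_coherence XY err(2))
      show "AE \<omega> in freq. ?g \<omega> \<le> Re (spec \<omega> Y Y - 2 * (trig_sum (S n) ?h \<omega> * spec \<omega> X Y)
         + trig_sum (S n) ?h \<omega> * cnj (trig_sum (S n) ?h \<omega>) * spec \<omega> X X)"
        using AE
      proof eventually_elim
        case (elim \<omega>)
        then show ?case unfolding filter_error_density[OF XY elim]
          using spectral_points_psd[OF elim, of X] by (simp add: psd_def)
      qed
    qed simp
  qed
  have "1 / (2 * pi) * (\<integral>\<omega>. ?g \<omega> \<partial>freq) \<le> 0"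
    by (rule LIMSEQ_le_const[OF lim[of 0]]) (use le in auto)
  then have "(\<integral>\<omega>. ?g \<omega> \<partial>freq) \<le> 0" by (simp add: field_simps)
  moreover have nonneg: "AE \<omega> in freq. 0 \<le> ?g \<omega>"
    using AE
  proof eventually_elim
    case (elim \<omega>)
    then show ?case using coherence_bounds[OF XY elim] spectral_points_psd[OF elim, of Y] by (simp add: psd_def)
  qed
  ultimately have "(\<integral>\<omega>. ?g \<omega> \<partial>freq) = 0"
    using integral_nonneg_AE[OF nonneg] by linarith
  then have "AE \<omega> in freq. ?g \<omega> = 0"
    using integral_nonneg_eq_0_iff_AE[OF integrable_psd_one_minus_coherence[OF XY] nonneg] by blast
  with AE show ?thesis
  proof eventually_elim
    case (elim \<omega>)
    then show ?case using spectral_points_psd[OF elim(1), of Y] by (simp add: psd_def)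
  qed
qed

text \<open>With full coherence the error of a filter is, up to 1/(2 pi), its squared distance from
  the Wiener filter \<open>W\<close> in L2(\<Phi>_X d\<omega>). There \<Phi>_X |W|^2 = \<Phi>_Y C
  \<le> \<Phi>_Y is integrable, so the density theorem applies to \<open>W\<close>.\<close>

lemma filtering_if_coherence_1:
  assumes XY: "X \<in> P" "Y \<in> P" and coh: "AE \<omega> in freq. coherence M X Y \<omega> = 1"
  shows "linear_filtering M X Y"
proof -
  have AE: "AE \<omega> in freq. \<omega> \<in> spectral_points {X, Y}" using XY by (intro AE_spectral_points) auto
  \<comment> \<open>The indicators extend functions measurable on the frequency interval to Borel
    functions on the line; outside the interval \<open>W\<close> is 0 / 0 = 0.\<close>
  define \<phi> where "\<phi> \<omega> = indicator {-pi..pi} \<omega> *\<^sub>R psd M X \<omega>" for \<omega>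
  define W where "W \<omega> = (indicator {-pi..pi} \<omega> *\<^sub>R spec \<omega> Y X) / (indicator {-pi..pi} \<omega> *\<^sub>R spec \<omega> X X)" for \<omega>
  have \<phi>: "integrable lborel \<phi>"
    using psd_integrable[OF XY(1)] unfolding integrable_freq_iff set_integrable_def \<phi>_def .
  have [measurable]: "(\<lambda>\<omega>. indicator {-pi..pi} \<omega> *\<^sub>R spec \<omega> Y X) \<in> borel_measurable borel"
    "(\<lambda>\<omega>. indicator {-pi..pi} \<omega> *\<^sub>R spec \<omega> X X) \<in> borel_measurable borel"
    using spec_integrable[OF XY(2,1)] spec_integrable[OF XY(1,1)]
    unfolding integrable_freq_iff set_integrable_def by (auto dest: borel_measurable_integrable)
  have W [measurable]: "W \<in> borel_measurable borel" unfolding W_def by measurable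
  have \<phi>m [measurable]: "\<phi> \<in> borel_measurable borel" using \<phi> by (auto dest: borel_measurable_integrable)
  define \<mu> where "\<mu> = density lborel (\<lambda>\<omega>. ennreal (\<phi> \<omega>))"
  have nn_\<mu>: "(\<integral>\<^sup>+\<omega>. ennreal (f \<omega>) \<partial>\<mu>) = (\<integral>\<^sup>+\<omega>. ennreal (psd M X \<omega> * f \<omega>) \<partial>freq)"
    if [measurable]: "f \<in> borel_measurable borel" and f: "\<And>\<omega>. f \<omega> \<ge> 0" for f
  proof -
    have "(\<integral>\<^sup>+\<omega>. ennreal (f \<omega>) \<partial>\<mu>) = (\<integral>\<^sup>+\<omega>. ennreal (\<phi> \<omega>) * ennreal (f \<omega>) \<partial>lborel)"
      unfolding \<mu>_def by (subst nn_integral_density) auto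
    also have "\<dots> = (\<integral>\<^sup>+\<omega>. ennreal (psd M X \<omega> * f \<omega>) * indicator {-pi..pi} \<omega> \<partial>lborel)"
      using f by (intro nn_integral_cong) (auto simp: \<phi>_def ennreal_mult'' split: split_indicator)
    finally show ?thesis by (simp add: nn_integral_restrict_space)
  qed
  interpret circle_measure \<mu>
  proof (intro circle_measure.intro circle_measure_axioms.intro finite_measureI)
    have "emeasure \<mu> (space \<mu>) = (\<integral>\<^sup>+\<omega>. ennreal (\<phi> \<omega>) \<partial>lborel)"
      unfolding \<mu>_def by (subst emeasure_density) auto
    also have "\<dots> \<le> (\<integral>\<^sup>+\<omega>. ennreal (norm (\<phi> \<omega>)) \<partial>lborel)"
      by (intro nn_integral_mono ennreal_leI) simp
    also have "\<dots> < \<infinity>" using \<phi> by (simp add: integrable_iff_bounded)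
    finally show "emeasure \<mu> (space \<mu>) \<noteq> \<infinity>" by simp
    show "sets \<mu> = sets borel" by (simp add: \<mu>_def)
    show "absolutely_continuous lborel \<mu>" unfolding \<mu>_def by (rule absolutely_continuousI_density) simp
    \<comment> \<open>The weight lives on the closed interval; its two endpoints form a null
      set.\<close>
    have "AE \<omega> in lborel. \<omega> \<noteq> -pi" "AE \<omega> in lborel. \<omega> \<noteq> pi" by (rule AE_lborel_singleton)+
    then show "AE \<omega> in \<mu>. \<omega> \<in> {-pi<..<pi}"
      unfolding \<mu>_def by (subst AE_density, simp, eventually_elim) (auto simp: \<phi>_def split: split_indicator_asm)
  qed
  have W_eq: "W \<omega> = spec \<omega> Y X / spec \<omega> X X" if "\<omega> \<in> space freq" for \<omega>
    using that by (simp add: W_def space_restrict_space)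
  have "(\<integral>\<^sup>+\<omega>. ennreal ((cmod (W \<omega>))\<^sup>2) \<partial>\<mu>) = (\<integral>\<^sup>+\<omega>. ennreal (psd M X \<omega> * (cmod (W \<omega>))\<^sup>2) \<partial>freq)"
    by (rule nn_\<mu>) auto
  also have "\<dots> \<le> (\<integral>\<^sup>+\<omega>. ennreal (norm (psd M Y \<omega>)) \<partial>freq)"
  proof (rule nn_integral_mono_AE)
    show "AE \<omega> in freq. ennreal (psd M X \<omega> * (cmod (W \<omega>))\<^sup>2) \<le> ennreal (norm (psd M Y \<omega>))"
      using AE AE_space
    proof eventually_elim
      case (elim \<omega>)
      have pos: "psd M X \<omega> > 0" "psd M Y \<omega> > 0" using elim(1) by (auto simp: spectral_points_def)
      have "psd M X \<omega> * (cmod (W \<omega>))\<^sup>2 = psd M Y \<omega> * coherence M X Y \<omega>"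
        using pos unfolding W_eq[OF elim(2)] spec_diag[OF XY(1) elim(1) XY(2)] coherence_def
        by (simp add: norm_divide power_divide power2_eq_square)
      also have "\<dots> \<le> psd M Y \<omega>" using pos coherence_bounds[OF XY elim(1)] by (simp add: mult_left_le)
      finally show ?case using pos by (intro ennreal_leI) simp
    qed
  qed
  also have "\<dots> < \<infinity>" using psd_integrable[OF XY(2)] by (simp add: integrable_iff_bounded)
  finally have approx: "trig_approximable W" by (intro trig_approximable_L2 W)
  have "\<exists>S h. finite S \<and> l2_dist W (trig_sum S h) < ennreal (1 / real (Suc n))" for n
  proof -
    have "0 < 1 / real (Suc n)" by simp
    then show ?thesis using approx unfolding trig_approximable_def trig_poly_def by metis
  qed
  then obtain S h where S: "\<And>n. finite (S n)" and h: "\<And>n. l2_dist W (trig_sum (S n) (h n)) < ennreal (1 / real (Suc n))"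
    by metis
  \<comment> \<open>The approximating coefficients are complex, whereas a filter must be real; their
    real parts are used, with one choice for all times \<open>t\<close>.\<close>
  have err: "(\<integral>\<xi>. (Y t \<xi> - (\<Sum>s\<in>S n. Re (h n s) * X (t - s) \<xi>))\<^sup>2 \<partial>M) \<le> 1 / (2 * pi) * (1 / real (Suc n))" for t n
  proof -
    let ?H = "trig_sum (S n) (h n)"
    let ?F = "\<lambda>\<omega>. Re (spec \<omega> Y Y - 2 * (?H \<omega> * spec \<omega> X Y) + ?H \<omega> * cnj (?H \<omega>) * spec \<omega> X X)"
    let ?e = "\<lambda>\<xi>. of_real (Y t \<xi>) - (\<Sum>s\<in>S n. h n s * of_real (X (t - s) \<xi>))"
    note E = filter_error_eq_integral[OF XY S[of n], where h = "h n"]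
    have [measurable]: "?H \<in> borel_measurable borel"
      using S by (intro borel_measurable_continuous_onI trig_poly_continuous) (auto simp: trig_poly_def)
    have F: "AE \<omega> in freq. ?F \<omega> = psd M X \<omega> * (cmod (W \<omega> - ?H \<omega>))\<^sup>2"
      using AE coh AE_space
    proof eventually_elim
      case (elim \<omega>)
      then show ?case using filter_error_density[OF XY elim(1), of "?H \<omega>"] W_eq[OF elim(3)] by simp
    qed
    have F0: "AE \<omega> in freq. 0 \<le> ?F \<omega>"
      using F AE
    proof eventually_elim
      case (elim \<omega>)
      then show ?case using spectral_points_psd[OF elim(2), of X] by (simp add: psd_def)
    qed
    have "ennreal (\<integral>\<omega>. ?F \<omega> \<partial>freq) = (\<integral>\<^sup>+\<omega>. ennreal (?F \<omega>) \<partial>freq)"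
      by (rule nn_integral_eq_integral[OF E(2) F0, symmetric])
    also have "\<dots> = (\<integral>\<^sup>+\<omega>. ennreal (psd M X \<omega> * (cmod (W \<omega> - ?H \<omega>))\<^sup>2) \<partial>freq)"
      using F by (intro nn_integral_cong_AE) (auto elim: eventually_mono)
    also have "\<dots> = l2_dist W ?H"
      unfolding l2_dist_def by (rule nn_\<mu>[symmetric]) auto
    also have "\<dots> \<le> ennreal (1 / real (Suc n))" using h[of n] by (rule less_imp_le)
    finally have "(\<integral>\<omega>. ?F \<omega> \<partial>freq) \<le> 1 / real (Suc n)" by (subst (asm) ennreal_le_iff) auto
    then have le: "(\<integral>\<xi>. (cmod (?e \<xi>))\<^sup>2 \<partial>M) \<le> 1 / (2 * pi) * (1 / real (Suc n))"
      unfolding E(3) by (intro mult_left_mono) auto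
    \<comment> \<open>The processes are real, so the error of the real filter is the real part of
      the complex error and no larger in modulus.\<close>
    have "(\<integral>\<xi>. (Y t \<xi> - (\<Sum>s\<in>S n. Re (h n s) * X (t - s) \<xi>))\<^sup>2 \<partial>M) \<le> (\<integral>\<xi>. (cmod (?e \<xi>))\<^sup>2 \<partial>M)"
    proof (rule integral_mono'[OF E(1)])
      fix \<xi>
      have e: "Y t \<xi> - (\<Sum>s\<in>S n. Re (h n s) * X (t - s) \<xi>) = Re (?e \<xi>)" by simp
      show "(Y t \<xi> - (\<Sum>s\<in>S n. Re (h n s) * X (t - s) \<xi>))\<^sup>2 \<le> (cmod (?e \<xi>))\<^sup>2"
        using power_mono[OF abs_Re_le_cmod abs_ge_zero, of "?e \<xi>" 2] unfolding e by (simp only: power2_abs)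
    qed simp
    with le show ?thesis by linarith
  qed
  have "(\<lambda>n. \<integral>\<xi>. (Y t \<xi> - (\<Sum>s\<in>S n. Re (h n s) * X (t - s) \<xi>))\<^sup>2 \<partial>M) \<longlonglongrightarrow> 0" for t
  proof (rule real_tendsto_sandwich)
    show "\<forall>\<^sub>F n in sequentially. 0 \<le> (\<integral>\<xi>. (Y t \<xi> - (\<Sum>s\<in>S n. Re (h n s) * X (t - s) \<xi>))\<^sup>2 \<partial>M)"
      by simp
    show "\<forall>\<^sub>F n in sequentially. (\<integral>\<xi>. (Y t \<xi> - (\<Sum>s\<in>S n. Re (h n s) * X (t - s) \<xi>))\<^sup>2 \<partial>M) \<le> 1 / (2 * pi) * (1 / real (Suc n))"
      by (rule always_eventually, rule allI, rule err)
    have "(\<lambda>n. 1 / (2 * pi) * inverse (real (Suc n))) \<longlonglongrightarrow> 1 / (2 * pi) * 0"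
      by (intro tendsto_mult tendsto_const LIMSEQ_inverse_real_of_nat)
    then show "(\<lambda>n. 1 / (2 * pi) * (1 / real (Suc n))) \<longlonglongrightarrow> 0"
      by (simp only: inverse_eq_divide mult_zero_right)
  qed (rule tendsto_const)
  then show ?thesis unfolding linear_filtering_def using S
    by (intro exI[of _ S] exI[of _ "\<lambda>n s. Re (h n s)"]) auto
qed

lemma linear_filtering_iff_coherence_1:
  "X \<in> P \<Longrightarrow> Y \<in> P \<Longrightarrow> linear_filtering M X Y \<longleftrightarrow> (AE \<omega> in freq. coherence M X Y \<omega> = 1)"
  using coherence_1_if_filtering filtering_if_coherence_1 by blast

section \<open>The pseudometric on processes\<close>

lemma coh_dist_eq: "coh_dist M X Y = sqrt (1 / (2 * pi) * (\<integral>\<omega>. 1 - coherence M X Y \<omega> \<partial>freq))"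
  unfolding coh_dist_def integral_freq_eq ..

lemma AE_one_minus_coherence_nonneg:
  assumes "X \<in> P" "Y \<in> P" shows "AE \<omega> in freq. 0 \<le> 1 - coherence M X Y \<omega>"
proof -
  have "AE \<omega> in freq. \<omega> \<in> spectral_points {X, Y}" using assms by (intro AE_spectral_points) auto
  then show ?thesis by eventually_elim (use coherence_bounds[OF assms] in auto)
qed

lemma coh_dist_nonneg: "X \<in> P \<Longrightarrow> Y \<in> P \<Longrightarrow> 0 \<le> coh_dist M X Y"
  unfolding coh_dist_eq by (intro real_sqrt_ge_zero mult_nonneg_nonneg integral_nonneg_AE AE_one_minus_coherence_nonneg) auto

lemma coh_dist_commute:
  assumes "X \<in> P" "Y \<in> P" shows "coh_dist M X Y = coh_dist M Y X"
proof -
  have "AE \<omega> in freq. \<omega> \<in> spectral_points {X, Y}" using assms by (intro AE_spectral_points) auto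
  then have "AE \<omega> in freq. 1 - coherence M X Y \<omega> = 1 - coherence M Y X \<omega>"
    by eventually_elim (use coherence_commute[OF assms] in auto)
  then have "(\<integral>\<omega>. 1 - coherence M X Y \<omega> \<partial>freq) = (\<integral>\<omega>. 1 - coherence M Y X \<omega> \<partial>freq)"
    using integrable_one_minus_coherence[OF assms] integrable_one_minus_coherence[OF assms(2,1)]
    by (intro integral_cong_AE) auto
  then show ?thesis by (simp add: coh_dist_eq)
qed

text \<open>The integrand 1 - C is nonnegative almost everywhere, so a zero integral means C = 1
  almost everywhere, which is filtering. One direction of filtering is therefore equivalent to the
  other.\<close>

lemma coh_dist_eq_0_iff:
  assumes "X \<in> P" "Y \<in> P" shows "coh_dist M X Y = 0 \<longleftrightarrow> linear_filtering M X Y"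
proof -
  have "coh_dist M X Y = 0 \<longleftrightarrow> (\<integral>\<omega>. 1 - coherence M X Y \<omega> \<partial>freq) = 0"
    by (simp add: coh_dist_eq)
  also have "\<dots> \<longleftrightarrow> (AE \<omega> in freq. 1 - coherence M X Y \<omega> = 0)"
    by (rule integral_nonneg_eq_0_iff_AE[OF integrable_one_minus_coherence[OF assms] AE_one_minus_coherence_nonneg[OF assms]])
  also have "\<dots> \<longleftrightarrow> (AE \<omega> in freq. coherence M X Y \<omega> = 1)"
    by (rule AE_cong) auto
  finally show ?thesis using linear_filtering_iff_coherence_1[OF assms] by simp
qed

lemma coh_dist_self:
  assumes "X \<in> P" shows "coh_dist M X X = 0"
proof -
  have "AE \<omega> in freq. \<omega> \<in> spectral_points {X}" using assms by (intro AE_spectral_points) auto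
  then have "AE \<omega> in freq. coherence M X X \<omega> = 1"
  proof eventually_elim
    case (elim \<omega>)
    then show ?case unfolding coherence_eq using assms
      by (intro kernel_coherence_self[of "{X}"] positive_kernel_spec spectral_points_psd[OF elim]) auto
  qed
  then show ?thesis using assms coh_dist_eq_0_iff linear_filtering_iff_coherence_1 by blast
qed

lemma coh_dist_triangle:
  assumes "X \<in> P" "Y \<in> P" "Z \<in> P"
  shows "coh_dist M X Z \<le> coh_dist M X Y + coh_dist M Y Z"
proof -
  let ?s = "\<lambda>A B \<omega>. sqrt (1 - coherence M A B \<omega>)"
  have "AE \<omega> in freq. \<omega> \<in> spectral_points {X, Y, Z}" using assms by (intro AE_spectral_points) auto
  then have tri: "AE \<omega> in freq. 0 \<le> ?s X Z \<omega> \<and> ?s X Z \<omega> \<le> ?s X Y \<omega> + ?s Y Z \<omega>"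
  proof eventually_elim
    case (elim \<omega>)
    have "\<omega> \<in> spectral_points {X, Z}" using elim by (auto simp: spectral_points_def)
    then have "0 \<le> ?s X Z \<omega>" using coherence_bounds[OF assms(1,3)] by simp
    \<comment> \<open>The order is reversed to match the exchanged arguments in
      \<open>coherence_eq\<close>.\<close>
    moreover have "positive_kernel {Z, Y, X} (spec \<omega>)"
      using positive_kernel_spec[OF _ _ elim] assms by (simp add: insert_commute)
    then have "?s X Z \<omega> \<le> ?s Y Z \<omega> + ?s X Y \<omega>"
      unfolding coherence_eq by (rule kernel_coherence_triangle) (auto intro: spectral_points_psd[OF elim])
    ultimately show ?case by simp
  qed
  \<comment> \<open>Squaring undoes the root only where C \<le> 1, hence only almost
    everywhere.\<close>
  have sq: "AE \<omega> in freq. (?s A B \<omega>)\<^sup>2 = 1 - coherence M A B \<omega>" if "A \<in> P" "B \<in> P" for A B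
    using AE_one_minus_coherence_nonneg[OF that] by (auto elim!: eventually_mono)
  have meas: "(\<lambda>\<omega>. (?s A B \<omega>)\<^sup>2) \<in> borel_measurable freq" if "A \<in> P" "B \<in> P" for A B
    using coherence_measurable[OF that] by measurable
  have int: "integrable freq (\<lambda>\<omega>. (?s A B \<omega>)\<^sup>2)" if "A \<in> P" "B \<in> P" for A B
    by (subst integrable_cong_AE[OF meas[OF that] _ sq[OF that]])
      (use integrable_one_minus_coherence[OF that] in auto)
  have eq: "coh_dist M A B = sqrt (1 / (2 * pi)) * sqrt (\<integral>\<omega>. (?s A B \<omega>)\<^sup>2 \<partial>freq)" if "A \<in> P" "B \<in> P" for A B
    unfolding coh_dist_eq real_sqrt_mult
    by (subst integral_cong_AE[OF meas[OF that] _ sq[OF that]])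
      (use integrable_one_minus_coherence[OF that] in auto)
  have "sqrt (\<integral>\<omega>. (?s X Z \<omega>)\<^sup>2 \<partial>freq) \<le> sqrt (\<integral>\<omega>. (?s X Y \<omega>)\<^sup>2 \<partial>freq) + sqrt (\<integral>\<omega>. (?s Y Z \<omega>)\<^sup>2 \<partial>freq)"
    using assms by (intro sqrt_integral_square_triangle int tri)
  then show ?thesis
    using assms by (simp add: eq distrib_left[symmetric] mult_left_mono del: real_sqrt_divide)
qed

section \<open>The quotient metric space\<close>

text \<open>Mutual filtering is distance zero, so the equivalence relation properties follow from
  those of a pseudometric, without composing filters.\<close>

lemma filter_equiv_iff:
  "(X, Y) \<in> filter_equiv M P \<longleftrightarrow> X \<in> P \<and> Y \<in> P \<and> coh_dist M X Y = 0"
  using coh_dist_eq_0_iff[of X Y] coh_dist_eq_0_iff[of Y X] coh_dist_commute[of X Y]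
  by (auto simp: filter_equiv_def)

lemma equiv_filter_equiv: "equiv P (filter_equiv M P)"
proof (rule equivI)
  show "filter_equiv M P \<subseteq> P \<times> P" by (auto simp: filter_equiv_def)
  show "refl_on P (filter_equiv M P)"
    by (rule refl_onI) (auto simp: filter_equiv_iff coh_dist_self)
  show "sym (filter_equiv M P)"
    by (rule symI) (auto simp: filter_equiv_iff coh_dist_commute)
  show "trans (filter_equiv M P)"
  proof (rule transI)
    fix X Y Z assume "(X, Y) \<in> filter_equiv M P" "(Y, Z) \<in> filter_equiv M P"
    then show "(X, Z) \<in> filter_equiv M P"
      using coh_dist_triangle[of X Y Z] coh_dist_nonneg[of X Z] by (simp add: filter_equiv_iff)
  qed
qed

text \<open>The distance descends to classes: moving to an equivalent process costs nothing in the
  triangle inequality.\<close>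

lemma coh_dist_cong:
  assumes "(X, X') \<in> filter_equiv M P" "(Y, Y') \<in> filter_equiv M P"
  shows "coh_dist M X Y = coh_dist M X' Y'"
proof -
  have P: "X \<in> P" "X' \<in> P" "Y \<in> P" "Y' \<in> P" and d: "coh_dist M X X' = 0" "coh_dist M Y Y' = 0"
    using assms by (auto simp: filter_equiv_iff)
  have d': "coh_dist M X' X = 0" "coh_dist M Y' Y = 0" using d P coh_dist_commute by auto
  have "coh_dist M X Y \<le> coh_dist M X' Y'"
    using coh_dist_triangle[of X X' Y] coh_dist_triangle[of X' Y' Y] P d d' by simp
  moreover have "coh_dist M X' Y' \<le> coh_dist M X Y"
    using coh_dist_triangle[of X' X Y'] coh_dist_triangle[of X Y Y'] P d d' by simp
  ultimately show ?thesis by simp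
qed

lemma quotient_metric:
  "\<exists>D. Metric_space (P // filter_equiv M P) D \<and>
     (\<forall>X\<in>P. \<forall>Y\<in>P. D (filter_equiv M P `` {X}) (filter_equiv M P `` {Y}) = coh_dist M X Y)"
proof -
  let ?E = "filter_equiv M P"
  let ?Q = "P // ?E"
  \<comment> \<open>\<open>Metric_space\<close> demands nonnegativity and symmetry for all
    arguments, also outside the carrier; the default 0 ensures both.\<close>
  define D where "D A B = (if A \<in> ?Q \<and> B \<in> ?Q then coh_dist M (SOME x. x \<in> A) (SOME y. y \<in> B) else 0)" for A B
  \<comment> \<open>The chosen representative of the class of \<open>X\<close> is equivalent to
    \<open>X\<close>, so by \<open>coh_dist_cong\<close> the choice does not affect
    \<open>D\<close>.\<close>
  have rep: "(X, SOME x. x \<in> ?E `` {X}) \<in> ?E" if "X \<in> P" for X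
    using someI[of "\<lambda>x. x \<in> ?E `` {X}" X] equiv_class_self[OF equiv_filter_equiv that] by simp
  have D: "D (?E `` {X}) (?E `` {Y}) = coh_dist M X Y" if "X \<in> P" "Y \<in> P" for X Y
    using that coh_dist_cong[OF rep[OF that(1)] rep[OF that(2)]] by (simp add: D_def quotientI)
  have "Metric_space ?Q D"
  proof
    show "0 \<le> D A B" for A B
      by (cases "A \<in> ?Q \<and> B \<in> ?Q") (auto elim!: quotientE simp: D coh_dist_nonneg, auto simp: D_def)
    show "D A B = D B A" for A B
    proof (cases "A \<in> ?Q \<and> B \<in> ?Q")
      case True
      then show ?thesis by (auto elim!: quotientE simp: D coh_dist_commute)
    qed (auto simp: D_def)
    show "D A B = 0 \<longleftrightarrow> A = B" if "A \<in> ?Q" "B \<in> ?Q" for A B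
    proof -
      obtain X where X: "X \<in> P" "A = ?E `` {X}" using \<open>A \<in> ?Q\<close> by (rule quotientE)
      obtain Y where Y: "Y \<in> P" "B = ?E `` {Y}" using \<open>B \<in> ?Q\<close> by (rule quotientE)
      note XY = X(1) Y(1) X(2) Y(2)
      then show ?thesis
        using eq_equiv_class_iff[OF equiv_filter_equiv XY(1,2)] D[OF XY(1,2)] by (simp only: filter_equiv_iff)
          simp
    qed
    show "D A C \<le> D A B + D B C" if "A \<in> ?Q" "B \<in> ?Q" "C \<in> ?Q" for A B C
      using that by (auto elim!: quotientE simp: D coh_dist_triangle)
  qed
  with D show ?thesis by blast
qed

end

theorem proposition4:
  fixes M :: "'a measure" and N :: nat and X :: "nat \<Rightarrow> int \<Rightarrow> 'a \<Rightarrow> real"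
  assumes "prob_space M"
    and "\<And>i j. i \<in> {1..N} \<Longrightarrow> j \<in> {1..N} \<Longrightarrow> jointly_wss M (X i) (X j)"
    and "\<And>i j. i \<in> {1..N} \<Longrightarrow> j \<in> {1..N} \<Longrightarrow> has_cross_psd M (X i) (X j)"
    and "\<And>i. i \<in> {1..N} \<Longrightarrow> AE \<omega> in lborel. \<omega> \<in> {-pi..pi} \<longrightarrow> psd M (X i) \<omega> > 0"
  defines "P \<equiv> X ` {1..N}"
  defines "E \<equiv> filter_equiv M P"
  shows "equiv P E \<and>
    (\<exists>D. Metric_space (P // E) D \<and>
         (\<forall>i\<in>{1..N}. \<forall>j\<in>{1..N}. D (E `` {X i}) (E `` {X j}) = coh_dist M (X i) (X j)))"
proof -
  interpret spectral_family M P
    by (rule spectral_family.intro) (use assms(2-4) in \<open>auto simp: P_def\<close>)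
  show ?thesis
    using equiv_filter_equiv quotient_metric unfolding E_def by (auto simp: P_def)
qed

end
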